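(* Let $\mathbb{K}$ be a field of characteristic zero and let $1\le m\le 2$. Let $\mathcal{T}_m$ be the T-ideal of $\mathbb{K}\langle X\rangle$ generated by the two polynomials $$[x_1,x_2,x_3][x_4,x_5,x_6]\quad\text{and}\quad [x_1,x_2][x_3,x_4]\cdots[x_{2m+3},x_{2m+4}].$$ Then $$T(UT_2(G^{(2m)}))=T(UT_2(G^{(2m+1)}))=\mathcal{T}_m.$$
   Context: $X=\{x_1,x_2,\dots\}$ is a countably infinite set and $\mathbb{K}\langle X\rangle$ is the free unital associative algebra on $X$. A T-ideal is an ideal of $\mathbb{K}\langle X\rangle$ invariant under all endomorphisms; $T(A)$ is the T-ideal of all polynomial identities of an algebra $A$. Commutators are $[a,b]=ab-ba$ and are left-normed: $[a,b,c]=[[a,b],c]$. $G^{(k)}$ is the (unital) Grassmann algebra of a $k$-dimensional $\mathbb{K}$-vector space, and $UT_2(R)$ is the algebra of $2\times2$ upper triangular matrices over $R$. *)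

theory Defs
  imports "HOL-Analysis.Cartesian_Space" "HOL-Library.Poly_Mapping" "HOL-Library.FSet"
begin

section \<open>The free unital associative algebra\<close>

text \<open>
  The free monoid is a copy of lists: \<^typ>\<open>'x list\<close> itself is left without a
  \<^class>\<open>monoid_add\<close> instance, so that no additive structure is imposed on all lists.
  The monoid operation (concatenation) is written additively because the convolution product of
  \<^typ>\<open>'a \<Rightarrow>\<^sub>0 'k\<close> is the monoid algebra of an additively written monoid.
\<close>

datatype 'x monomial = Monomial (letters: "'x list")

instantiation monomial :: (type) monoid_add
begin

definition zero_monomial :: "'x monomial"
  where "zero_monomial = Monomial []"

definition plus_monomial :: "'x monomial \<Rightarrow> 'x monomial \<Rightarrow> 'x monomial"
  where "plus_monomial u v = Monomial (letters u @ letters v)"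

instance
  by standard (simp_all add: zero_monomial_def plus_monomial_def)

end

type_synonym 'k free_alg = "nat monomial \<Rightarrow>\<^sub>0 'k"

text \<open>The variables are numbered from 0, that is, \<open>var i\<close> stands for $x_{i+1}$.\<close>

definition var :: "nat \<Rightarrow> 'k::zero_neq_one free_alg"
  where "var i = Poly_Mapping.single (Monomial [i]) 1"

definition free_scale :: "'k::semiring_0 \<Rightarrow> 'k free_alg \<Rightarrow> 'k free_alg"
  where "free_scale c = Poly_Mapping.map ((*) c)"

definition commutator :: "'a::ring \<Rightarrow> 'a \<Rightarrow> 'a"
  where "commutator a b = a * b - b * a"


section \<open>T-ideals\<close>

definition two_sided_ideal :: "'a::ring_1 set \<Rightarrow> bool"
  where "two_sided_ideal I \<longleftrightarrow>
    0 \<in> I \<and> (\<forall>f\<in>I. \<forall>g\<in>I. f + g \<in> I) \<and> (\<forall>f\<in>I. \<forall>g. g * f \<in> I \<and> f * g \<in> I)"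

definition free_endomorphism :: "('k::field free_alg \<Rightarrow> 'k free_alg) \<Rightarrow> bool"
  where "free_endomorphism \<phi> \<longleftrightarrow>
    (\<forall>f g. \<phi> (f + g) = \<phi> f + \<phi> g) \<and> (\<forall>c f. \<phi> (free_scale c f) = free_scale c (\<phi> f)) \<and>
    (\<forall>f g. \<phi> (f * g) = \<phi> f * \<phi> g) \<and> \<phi> 1 = 1"

definition T_ideal :: "'k::field free_alg set \<Rightarrow> bool"
  where "T_ideal I \<longleftrightarrow> two_sided_ideal I \<and> (\<forall>\<phi>. free_endomorphism \<phi> \<longrightarrow> \<phi> ` I \<subseteq> I)"

text \<open>
  The T-ideal generated by a set \<open>S\<close> is \<open>T_ideal hull S\<close>.

  A unital algebra over \<^typ>\<open>'k\<close> is presented as a unital subalgebra \<open>A\<close> of an ambient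
  type of class \<^class>\<open>ring_1\<close>, together with the action \<open>smul\<close> of the scalars.
\<close>

definition eval_poly ::
    "('k::zero \<Rightarrow> 'a::ring_1 \<Rightarrow> 'a) \<Rightarrow> (nat \<Rightarrow> 'a) \<Rightarrow> 'k free_alg \<Rightarrow> 'a"
  where "eval_poly smul a f =
    (\<Sum>w\<in>Poly_Mapping.keys f. smul (Poly_Mapping.lookup f w) (prod_list (map a (letters w))))"

definition polynomial_identities ::
    "('k::zero \<Rightarrow> 'a::ring_1 \<Rightarrow> 'a) \<Rightarrow> 'a set \<Rightarrow> 'k free_alg set"
  where "polynomial_identities smul A =
    {f. \<forall>a. (\<forall>i. a i \<in> A) \<longrightarrow> eval_poly smul a f = 0}"


section \<open>Grassmann algebras\<close>

text \<open>
  Let $V$ have the basis $e_0, e_1, \dots$. The products $e_S = e_{i_1} \cdots e_{i_r}$ with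
  $S = \{i_1 < \cdots < i_r\}$ form a basis of the Grassmann algebra of $V$, and
  $e_S e_T = \pm e_{S \cup T}$ if $S$ and $T$ are disjoint, $e_S e_T = 0$ otherwise.
  The sign is the parity of the number of transpositions that sort the juxtaposition of $S$
  and $T$.
\<close>

typedef (overloaded) 'k grassmann = "UNIV :: (nat fset \<Rightarrow>\<^sub>0 'k::zero) set"
  morphisms gcoeffs Grassmann by simp

setup_lifting type_definition_grassmann

definition gsign :: "nat fset \<Rightarrow> nat fset \<Rightarrow> 'k::ring_1"
  where "gsign S T =
    (if S |\<inter>| T = {||} then (- 1) ^ card {(s, t). s |\<in>| S \<and> t |\<in>| T \<and> t < s} else 0)"

definition gmult ::
    "(nat fset \<Rightarrow>\<^sub>0 'k::ring_1) \<Rightarrow> (nat fset \<Rightarrow>\<^sub>0 'k) \<Rightarrow> (nat fset \<Rightarrow>\<^sub>0 'k)"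
  where "gmult f g = (\<Sum>S\<in>Poly_Mapping.keys f. \<Sum>T\<in>Poly_Mapping.keys g.
    Poly_Mapping.single (S |\<union>| T)
      (gsign S T * (Poly_Mapping.lookup f S * Poly_Mapping.lookup g T)))"

lemma gmult_superset:
  assumes "finite A" "Poly_Mapping.keys f \<subseteq> A" "finite B" "Poly_Mapping.keys g \<subseteq> B"
  shows "gmult f g = (\<Sum>S\<in>A. \<Sum>T\<in>B. Poly_Mapping.single (S |\<union>| T)
    (gsign S T * (Poly_Mapping.lookup f S * Poly_Mapping.lookup g T)))"
proof -
  have "gmult f g = (\<Sum>S\<in>Poly_Mapping.keys f. \<Sum>T\<in>B. Poly_Mapping.single (S |\<union>| T)
    (gsign S T * (Poly_Mapping.lookup f S * Poly_Mapping.lookup g T)))"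
    unfolding gmult_def using assms
    by (intro sum.cong refl sum.mono_neutral_left) (auto simp: in_keys_iff)
  also have "\<dots> = (\<Sum>S\<in>A. \<Sum>T\<in>B. Poly_Mapping.single (S |\<union>| T)
    (gsign S T * (Poly_Mapping.lookup f S * Poly_Mapping.lookup g T)))"
    using assms by (intro sum.mono_neutral_left) (auto simp: in_keys_iff)
  finally show ?thesis .
qed

lemma gmult_add_left: "gmult (f + g) h = gmult f h + gmult g h"
proof -
  let ?A = "Poly_Mapping.keys f \<union> Poly_Mapping.keys g" and ?B = "Poly_Mapping.keys h"
  have k: "Poly_Mapping.keys (f + g) \<subseteq> ?A"
    by (rule Poly_Mapping.keys_add)
  show ?thesis
    by (simp add: gmult_superset[of ?A _ ?B] k lookup_add distrib_left distrib_right single_add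
        sum.distrib)
qed

lemma gmult_add_right: "gmult h (f + g) = gmult h f + gmult h g"
proof -
  let ?A = "Poly_Mapping.keys f \<union> Poly_Mapping.keys g" and ?B = "Poly_Mapping.keys h"
  have k: "Poly_Mapping.keys (f + g) \<subseteq> ?A"
    by (rule Poly_Mapping.keys_add)
  show ?thesis
    by (simp add: gmult_superset[of ?B _ ?A] k lookup_add distrib_left distrib_right single_add
        sum.distrib)
qed

lemma gmult_zero [simp]: "gmult 0 g = 0" "gmult f 0 = 0"
  by (simp_all add: gmult_def)

lemma gmult_single:
  "gmult (Poly_Mapping.single S a) (Poly_Mapping.single T b) =
    Poly_Mapping.single (S |\<union>| T) (gsign S T * (a * b))"
  by (subst gmult_superset[of "{S}" _ "{T}"]) auto

lemma poly_mapping_single_induct [case_names zero single add]: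
  fixes f :: "'a \<Rightarrow>\<^sub>0 'b::monoid_add"
  assumes "P 0" "\<And>x c. P (Poly_Mapping.single x c)" "\<And>f g. P f \<Longrightarrow> P g \<Longrightarrow> P (f + g)"
  shows "P f"
proof (induction f rule: update_induct)
  case const
  show ?case by (rule assms)
next
  case (update f a b)
  have "Poly_Mapping.update a b f = f + Poly_Mapping.single a b"
    using update.hyps(1)
    by (intro poly_mapping_eqI)
      (auto simp: lookup_update lookup_add lookup_single in_keys_iff when_def)
  then show ?case using update.IH assms by simp
qed

lemma gsign_commute: "gsign S T * (c :: 'k::ring_1) = c * gsign S T"
proof -
  have "(- 1) ^ n * c = c * (- 1 :: 'k) ^ n" for n
    by (induction n) simp_all
  then show ?thesis by (simp add: gsign_def)
qed

lemma gsign_assoc: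
  "gsign S T * gsign (S |\<union>| T) U = (gsign T U * gsign S (T |\<union>| U) :: 'k::ring_1)"
proof (cases "S |\<inter>| T = {||} \<and> S |\<inter>| U = {||} \<and> T |\<inter>| U = {||}")
  case True
  define I where "I A B = {(s, t). s |\<in>| A \<and> t |\<in>| B \<and> t < s}" for A B :: "nat fset"
  have fin: "finite (I A B)" for A B
    by (rule finite_subset[of _ "fset A \<times> fset B"]) (auto simp: I_def)
  have "I (S |\<union>| T) U = I S U \<union> I T U" "I S U \<inter> I T U = {}"
    using True by (auto simp: I_def)
  then have 1: "card (I (S |\<union>| T) U) = card (I S U) + card (I T U)"
    by (simp add: card_Un_disjoint fin)
  have "I S (T |\<union>| U) = I S T \<union> I S U" "I S T \<inter> I S U = {}"
    using True by (auto simp: I_def)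
  then have 2: "card (I S (T |\<union>| U)) = card (I S T) + card (I S U)"
    by (simp add: card_Un_disjoint fin)
  have g: "gsign A B = (if A |\<inter>| B = {||} then (- 1) ^ card (I A B) else (0::'k))" for A B
    by (simp add: gsign_def I_def)
  have "(S |\<union>| T) |\<inter>| U = {||}" "S |\<inter>| (T |\<union>| U) = {||}"
    using True by auto
  then show ?thesis
    using True by (simp add: g 1 2 flip: power_add) (simp add: ac_simps)
next
  case False
  then consider "S |\<inter>| T \<noteq> {||}" | "S |\<inter>| U \<noteq> {||}" | "T |\<inter>| U \<noteq> {||}"
    by blast
  then show ?thesis
  proof cases
    case 1
    then have "S |\<inter>| (T |\<union>| U) \<noteq> {||}" by auto
    with 1 show ?thesis by (simp add: gsign_def)
  next
    case 2
    then have "S |\<inter>| (T |\<union>| U) \<noteq> {||}" "(S |\<union>| T) |\<inter>| U \<noteq> {||}" by auto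
    then show ?thesis by (simp add: gsign_def)
  next
    case 3
    then have "(S |\<union>| T) |\<inter>| U \<noteq> {||}" by auto
    with 3 show ?thesis by (simp add: gsign_def)
  qed
qed

lemma gmult_assoc: "gmult (gmult f g) h = gmult f (gmult g h)"
proof (induction f rule: poly_mapping_single_induct)
  case (single S a)
  show ?case
  proof (induction g rule: poly_mapping_single_induct)
    case (single T b)
    show ?case
    proof (induction h rule: poly_mapping_single_induct)
      case (single U c)
      have "gsign (S |\<union>| T) U * (gsign S T * (a * b) * c) =
          (gsign S T * gsign (S |\<union>| T) U) * (a * b * c)"
        by (metis gsign_commute mult.assoc)
      also have "\<dots> = gsign S (T |\<union>| U) * (a * (gsign T U * (b * c)))"
        unfolding gsign_assoc by (metis gsign_commute mult.assoc)
      finally show ?case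
        by (simp add: gmult_single funion_assoc)
    qed (simp_all add: gmult_add_left gmult_add_right)
  qed (simp_all add: gmult_add_left gmult_add_right)
qed (simp_all add: gmult_add_left gmult_add_right)

lemma gsign_empty [simp]: "gsign {||} T = 1" "gsign S {||} = 1"
  by (simp_all add: gsign_def)

lemma gmult_one: "gmult (Poly_Mapping.single {||} 1) f = f" "gmult f (Poly_Mapping.single {||} 1) = f"
  by (induction f rule: poly_mapping_single_induct)
    (simp_all add: gmult_add_left gmult_add_right gmult_single)

instantiation grassmann :: (ring_1) ring_1
begin

lift_definition zero_grassmann :: "'a grassmann" is 0 .
lift_definition one_grassmann :: "'a grassmann" is "Poly_Mapping.single {||} 1" .
lift_definition plus_grassmann :: "'a grassmann \<Rightarrow> 'a grassmann \<Rightarrow> 'a grassmann" is "(+)" .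
lift_definition minus_grassmann :: "'a grassmann \<Rightarrow> 'a grassmann \<Rightarrow> 'a grassmann" is "(-)" .
lift_definition uminus_grassmann :: "'a grassmann \<Rightarrow> 'a grassmann" is uminus .
lift_definition times_grassmann :: "'a grassmann \<Rightarrow> 'a grassmann \<Rightarrow> 'a grassmann" is gmult .

instance
proof
  show "0 \<noteq> (1 :: 'a grassmann)"
    by transfer (metis lookup_single_eq lookup_zero zero_neq_one)
qed (transfer; simp add: gmult_assoc gmult_one gmult_add_left gmult_add_right add.assoc
    add.commute)+

end

lift_definition grassmann_scale :: "'k::semiring_0 \<Rightarrow> 'k grassmann \<Rightarrow> 'k grassmann"
  is "\<lambda>c. Poly_Mapping.map ((*) c)" .

lift_definition ggen :: "nat \<Rightarrow> 'k::zero_neq_one grassmann"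
  is "\<lambda>i. Poly_Mapping.single {|i|} 1" .

lemma ggen_anticommute: "ggen i * ggen j = - (ggen j * ggen i :: 'k::ring_1 grassmann)"
proof (cases "i = j")
  case True
  then show ?thesis by transfer (simp add: gmult_single gsign_def)
next
  case False
  have "{(s, t). s = i \<and> t = j \<and> t < s} = (if j < i then {(i, j)} else {})" for i j :: nat
    by auto
  with False show ?thesis
    by transfer (auto simp: gmult_single gsign_def finsert_commute single_uminus)
qed

lemma ggen_square: "ggen i * ggen i = (0 :: 'k::ring_1 grassmann)"
  by transfer (simp add: gmult_single gsign_def)

text \<open>The Grassmann algebra of the span of $e_0, \dots, e_{k-1}$.\<close>

definition grassmann_alg :: "nat \<Rightarrow> 'k::zero grassmann set"
  where "grassmann_alg k = {g. \<forall>S\<in>Poly_Mapping.keys (gcoeffs g). fset S \<subseteq> {..<k}}"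


section \<open>Upper triangular matrices\<close>

typedef (overloaded) 'a upper2 = "{M :: 'a::zero^2^2. M $ 2 $ 1 = 0}"
  morphisms upper2_matrix Upper2
  by (rule exI[of _ 0]) simp

setup_lifting type_definition_upper2

instantiation upper2 :: (ring_1) ring_1
begin

lift_definition zero_upper2 :: "'a upper2" is 0 by simp
lift_definition one_upper2 :: "'a upper2" is "mat 1" by (simp add: mat_def)
lift_definition plus_upper2 :: "'a upper2 \<Rightarrow> 'a upper2 \<Rightarrow> 'a upper2" is "(+)" by simp
lift_definition minus_upper2 :: "'a upper2 \<Rightarrow> 'a upper2 \<Rightarrow> 'a upper2" is "(-)" by simp
lift_definition uminus_upper2 :: "'a upper2 \<Rightarrow> 'a upper2" is uminus by simp
lift_definition times_upper2 :: "'a upper2 \<Rightarrow> 'a upper2 \<Rightarrow> 'a upper2" is "(**)"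
  by (simp add: matrix_matrix_mult_def sum_2)

instance
proof
  show "0 \<noteq> (1 :: 'a upper2)"
    by transfer (auto simp: vec_eq_iff mat_def)
qed (transfer; simp add: matrix_mul_assoc vec_eq_iff matrix_matrix_mult_def sum_2
    distrib_left distrib_right mat_def forall_2 algebra_simps)+

end

text \<open>The entrywise action; \<open>smul c 0 = 0\<close> guarantees that the result is upper triangular.\<close>

definition upper2_scale ::
    "('k \<Rightarrow> 'a::zero \<Rightarrow> 'a) \<Rightarrow> 'k \<Rightarrow> 'a upper2 \<Rightarrow> 'a upper2"
  where "upper2_scale smul c M = Upper2 (\<chi> i j. smul c (upper2_matrix M $ i $ j))"

lemma upper2_matrix_scale:
  assumes "smul c 0 = 0"
  shows "upper2_matrix (upper2_scale smul c M) = (\<chi> i j. smul c (upper2_matrix M $ i $ j))"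
  unfolding upper2_scale_def using upper2_matrix[of M] assms
  by (subst Upper2_inverse) simp_all

lemma grassmann_scale_zero: "grassmann_scale c 0 = 0"
  by transfer (rule poly_mapping_eqI, simp add: Poly_Mapping.map.rep_eq when_def)

definition UT2 :: "'a::zero set \<Rightarrow> 'a upper2 set"
  where "UT2 R = {M. \<forall>i j. upper2_matrix M $ i $ j \<in> R}"

end

theory Submission
  imports Defs "HOL-Library.Set_Algebras" "HOL-Library.Multiset"
begin

text \<open>
  Let \<open>F\<close> be the free algebra, \<open>C\<close> its commutator ideal and \<open>T\<close> the ideal generated by all
  commutators \<open>[[f, g], h]\<close>. A product of generators with arbitrary factors in between can be
  rewritten by \<open>[b, h] v = [b, h v] - h [b, v]\<close>, so the T-ideal generated by the two polynomials
  contains \<open>T T\<close> and \<open>C\<^sup>m\<^sup>+\<^sup>2\<close>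
  (\<open>triple_products_in_T_ideal\<close>, \<open>commutator_products_in_T_ideal\<close>).

  Commutators of a Grassmann algebra are central and have degree at least 2. Evaluated at upper
  triangular matrices, an element of \<open>T\<close> therefore has zero diagonal, and every summand in the corner of
  a product of \<open>m + 2\<close> commutators contains \<open>m + 1\<close> diagonal commutators, so it has degree at
  least \<open>2 m + 2\<close>. Hence both polynomials are identities for \<open>2 m + 1\<close> generators. The identities
  for \<open>2 m + 1\<close> generators are identities for \<open>2 m\<close> generators, and it remains to show that the
  latter lie in \<open>T T + C\<^sup>m\<^sup>+\<^sup>2\<close>.

  The upper right entry \<open>D\<close> of an evaluation satisfies \<open>D (f g) = f(a) D g + D f g(b)\<close>, where the
  two diagonals \<open>a\<close> and \<open>b\<close> can be chosen independently of each other. Over the field, words can be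
  sorted modulo \<open>C C\<close>, up to terms that \<open>D\<close> separates because distinct monomials are independent
  functions; so the identities of upper triangular matrices over the field lie in \<open>C C\<close>
  (\<open>identities_of_UT2_field\<close>).

  Grassmann generators reduce everything to this case. Since \<open>C = T + \<Sum> F [x\<^sub>i, x\<^sub>j]\<close>, summed over
  \<open>i < j\<close>, and likewise with \<open>F\<close> on the right, an element of \<open>C C\<close> is modulo \<open>T T\<close> a sum of terms
  \<open>c [x\<^sub>i, x\<^sub>j]\<close> and \<open>[x\<^sub>i, x\<^sub>j] t\<close> with \<open>c\<close> in \<open>C\<close> and \<open>t\<close> in \<open>T\<close>. Let \<open>a\<close> consist of
  scalars and \<open>b\<close> of scalars, except that two anticommuting generators are added to \<open>b\<^sub>i\<close> and
  \<open>b\<^sub>j\<close>. This kills all terms but \<open>c [x\<^sub>i, x\<^sub>j]\<close> and leaves the scalar value of \<open>D c\<close> times a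
  nonzero element. So \<open>c\<close> lies in \<open>C C\<close> and the term in \<open>C C C\<close>; exchanging the roles of \<open>a\<close> and
  \<open>b\<close> settles the terms \<open>[x\<^sub>i, x\<^sub>j] t\<close> (\<open>identities_two\<close>).

  With four generators the same argument is applied once more. An element of \<open>C C C\<close> is modulo
  \<open>T T\<close> a sum of terms \<open>[x\<^sub>i, x\<^sub>j] c [x\<^sub>k, x\<^sub>l]\<close>, \<open>t [x\<^sub>i, x\<^sub>j] [x\<^sub>k, x\<^sub>l]\<close> and
  \<open>[x\<^sub>i, x\<^sub>j] [x\<^sub>k, x\<^sub>l] t\<close>, where in the last two kinds \<open>i < j < k < l\<close> can be assumed, because
  modulo \<open>T\<close> a product of two commutators is alternating in its four entries. Placing two generators
  on either diagonal, or all four on one of them, isolates the coefficients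
  (\<open>identities_four\<close>). A third commutator would put two adjacent commutators next to a coefficient
  that is not in \<open>T\<close>, and an evaluation sees such a pair only modulo \<open>T\<close>; this is why the argument
  stops at \<open>m = 2\<close>.
\<close>

section \<open>Evaluation of noncommutative polynomials\<close>

lemma letters_zero [simp]: "letters 0 = []"
  by (simp add: zero_monomial_def)

text \<open>
  The hypotheses on \<open>smul\<close> are those of a unital associative algebra; under them evaluation is a
  homomorphism. The locale is instantiated with the free algebra (where evaluation is substitution),
  the Grassmann algebra, the field itself, and upper triangular matrices over any of these.
\<close>

locale scalar_action =
  fixes smul :: "'k::field \<Rightarrow> 'a::ring_1 \<Rightarrow> 'a"
  assumes smul_add_right: "smul c (x + y) = smul c x + smul c y"
    and smul_add_left: "smul (c + d) x = smul c x + smul d x"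
    and smul_smul: "smul c (smul d x) = smul (c * d) x"
    and smul_one: "smul 1 x = x"
    and smul_mult_left: "smul c x * y = smul c (x * y)"
    and smul_mult_right: "x * smul c y = smul c (x * y)"
begin

lemma smul_zero_left [simp]: "smul 0 x = 0"
  using smul_add_left[of 0 0 x] by simp

lemma smul_zero_right [simp]: "smul c 0 = 0"
  using smul_add_right[of c 0 0] by simp

lemma smul_sum: "smul c (sum f A) = (\<Sum>x\<in>A. smul c (f x))"
  by (induction A rule: infinite_finite_induct) (simp_all add: smul_add_right)

lemma smul_sum_left: "smul (sum f A) y = (\<Sum>x\<in>A. smul (f x) y)"
  by (induction A rule: infinite_finite_induct) (simp_all add: smul_add_left)

lemma eval_superset:
  assumes "finite A" "Poly_Mapping.keys f \<subseteq> A"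
  shows "eval_poly smul a f =
    (\<Sum>w\<in>A. smul (Poly_Mapping.lookup f w) (prod_list (map a (letters w))))"
  unfolding eval_poly_def using assms
  by (intro sum.mono_neutral_left) (auto simp: in_keys_iff)

lemma eval_single [simp]:
  "eval_poly smul a (Poly_Mapping.single w c) = smul c (prod_list (map a (letters w)))"
  by (subst eval_superset[of "{w}"]) auto

lemma eval_zero [simp]: "eval_poly smul a 0 = 0"
  by (simp add: eval_poly_def)

lemma eval_add [simp]: "eval_poly smul a (f + g) = eval_poly smul a f + eval_poly smul a g"
proof -
  let ?A = "Poly_Mapping.keys f \<union> Poly_Mapping.keys g"
  have "Poly_Mapping.keys (f + g) \<subseteq> ?A"
    by (rule Poly_Mapping.keys_add)
  then show ?thesis
    by (simp add: eval_superset[of ?A] lookup_add smul_add_left sum.distrib)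
qed

lemma eval_uminus [simp]: "eval_poly smul a (- f) = - eval_poly smul a f"
  using eval_add[of a f "- f"] by (simp add: eq_neg_iff_add_eq_0 add.commute)

lemma eval_diff [simp]: "eval_poly smul a (f - g) = eval_poly smul a f - eval_poly smul a g"
  using eval_add[of a f "- g"] by simp

lemma eval_mult [simp]: "eval_poly smul a (f * g) = eval_poly smul a f * eval_poly smul a g"
proof (induction f rule: poly_mapping_single_induct)
  case (single v c)
  show ?case
  proof (induction g rule: poly_mapping_single_induct)
    case (single w d)
    show ?case
      by (simp add: mult_single plus_monomial_def smul_mult_left smul_mult_right smul_smul mult.commute[of d c])
  qed (simp_all add: distrib_left)
qed (simp_all add: distrib_right)

lemma eval_const [simp]: "eval_poly smul a (Poly_Mapping.single 0 c) = smul c 1"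
  by simp

lemma eval_one [simp]: "eval_poly smul a 1 = 1"
  by (simp flip: single_one add: smul_one)

lemma eval_var [simp]: "eval_poly smul a (var i) = a i"
  by (simp add: var_def smul_one)

lemma eval_sum [simp]: "eval_poly smul a (sum f A) = (\<Sum>x\<in>A. eval_poly smul a (f x))"
  by (induction A rule: infinite_finite_induct) simp_all

lemma eval_prod_list: "eval_poly smul a (prod_list fs) = prod_list (map (eval_poly smul a) fs)"
  by (induction fs) simp_all

lemma eval_commutator [simp]:
  "eval_poly smul a (commutator f g) = commutator (eval_poly smul a f) (eval_poly smul a g)"
  by (simp add: commutator_def)

end

text \<open>
  Scalars acting through a homomorphism into the centre always give an algebra; all instances
  except the matrices arise in this way.
\<close>

lemma scalar_action_central:
  fixes \<iota> :: "'k::field \<Rightarrow> 'a::ring_1"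
  assumes "\<And>c x. smul c x = \<iota> c * x" "\<And>c d. \<iota> (c + d) = \<iota> c + \<iota> d"
    and "\<And>c d. \<iota> (c * d) = \<iota> c * \<iota> d" "\<iota> 1 = 1" "\<And>c x. \<iota> c * x = x * \<iota> c"
  shows "scalar_action smul"
proof
  fix c d x y
  show "x * smul c y = smul c (x * y)"
    by (metis assms(1,5) mult.assoc)
qed (simp_all add: assms(1-4) distrib_left distrib_right mult.assoc)

lemma single_zero_commutes:
  "Poly_Mapping.single 0 c * f = f * (Poly_Mapping.single 0 c :: 'k::field free_alg)"
  by (induction f rule: poly_mapping_single_induct)
    (simp_all add: distrib_left distrib_right mult_single mult.commute)

lemma map_mult_single:
  "Poly_Mapping.map ((*) c) (Poly_Mapping.single w d) = Poly_Mapping.single w (c * d :: 'k::field)"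
  by (rule poly_mapping_eqI) (simp add: Poly_Mapping.map.rep_eq lookup_single when_def)

lemma map_mult_add:
  "Poly_Mapping.map ((*) c) (f + g) =
    Poly_Mapping.map ((*) c) f + Poly_Mapping.map ((*) (c::'k::field)) g"
  by (rule poly_mapping_eqI) (simp add: Poly_Mapping.map.rep_eq lookup_add when_def flip: distrib_left)

lemma free_scale_eq_mult: "free_scale c f = Poly_Mapping.single 0 c * (f :: 'k::field free_alg)"
  unfolding free_scale_def
proof (induction f rule: poly_mapping_single_induct)
  case zero
  show ?case by (rule poly_mapping_eqI) (simp add: Poly_Mapping.map.rep_eq when_def)
qed (simp_all add: map_mult_single map_mult_add distrib_left mult_single)

interpretation free: scalar_action "free_scale :: 'k::field \<Rightarrow> 'k free_alg \<Rightarrow> 'k free_alg"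
  by (rule scalar_action_central[where \<iota> = "Poly_Mapping.single 0"])
    (simp_all add: free_scale_eq_mult single_add mult_single single_zero_commutes)

lift_definition gconst :: "'k::zero \<Rightarrow> 'k grassmann" is "Poly_Mapping.single {||}" .

lemma grassmann_scale_eq_mult: "grassmann_scale c x = gconst (c::'k::field) * x"
proof transfer
  fix c :: 'k and x
  show "Poly_Mapping.map ((*) c) x = gmult (Poly_Mapping.single {||} c) x"
  proof (induction x rule: poly_mapping_single_induct)
    case zero
    show ?case by (rule poly_mapping_eqI) (simp add: Poly_Mapping.map.rep_eq when_def)
  qed (simp_all add: map_mult_single map_mult_add gmult_add_right gmult_single)
qed

lemma gconst_commutes: "gconst c * x = x * gconst (c::'k::field)"
proof transfer
  fix c :: 'k and x
  show "gmult (Poly_Mapping.single {||} c) x = gmult x (Poly_Mapping.single {||} c)"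
    by (induction x rule: poly_mapping_single_induct)
      (simp_all add: gmult_add_left gmult_add_right gmult_single mult.commute)
qed

interpretation gr: scalar_action "grassmann_scale :: 'k::field \<Rightarrow> 'k grassmann \<Rightarrow> 'k grassmann"
proof (rule scalar_action_central[where \<iota> = gconst])
  show "gconst 1 = (1 :: 'k grassmann)" by transfer simp
  show "gconst (c + d) = gconst c + gconst d" for c d :: 'k
    by transfer (simp add: single_add)
  show "gconst (c * d) = gconst c * gconst d" for c d :: 'k
    by transfer (simp add: gmult_single)
qed (simp_all add: grassmann_scale_eq_mult gconst_commutes)

interpretation base: scalar_action "(*) :: 'k::field \<Rightarrow> 'k \<Rightarrow> 'k"
  by standard (simp_all add: algebra_simps)


lift_definition tri :: "'a::zero \<Rightarrow> 'a \<Rightarrow> 'a \<Rightarrow> 'a upper2"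
  is "\<lambda>a m b. \<chi> i j. if i = 1 then (if j = 1 then a else m) else (if j = 1 then 0 else b)"
  by simp

definition ul :: "'a::zero upper2 \<Rightarrow> 'a" where "ul M = upper2_matrix M $ 1 $ 1"
definition ur :: "'a::zero upper2 \<Rightarrow> 'a" where "ur M = upper2_matrix M $ 1 $ 2"
definition lr :: "'a::zero upper2 \<Rightarrow> 'a" where "lr M = upper2_matrix M $ 2 $ 2"

lemma upper2_lower_left: "upper2_matrix M $ 2 $ 1 = (0::'a::zero)"
  using upper2_matrix[of M] by simp

lemma upper2_eq_iff: "M = N \<longleftrightarrow> ul M = ul N \<and> ur M = ur N \<and> lr M = lr N"
  unfolding ul_def ur_def lr_def upper2_matrix_inject[symmetric]
  by (auto simp: vec_eq_iff forall_2 upper2_lower_left)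

lemma tri_entries [simp]: "ul (tri a m b) = a" "ur (tri a m b) = m" "lr (tri a m b) = b"
  by (simp_all add: ul_def ur_def lr_def tri.rep_eq)

lemma upper2_entries [simp]:
  fixes M N :: "'a::ring_1 upper2"
  shows "ul (M * N) = ul M * ul N" "lr (M * N) = lr M * lr N"
    "ur (M * N) = ul M * ur N + ur M * lr N"
    "ul (M + N) = ul M + ul N" "lr (M + N) = lr M + lr N" "ur (M + N) = ur M + ur N"
    "ul (M - N) = ul M - ul N" "lr (M - N) = lr M - lr N" "ur (M - N) = ur M - ur N"
    "ul (- M) = - ul M" "lr (- M) = - lr M" "ur (- M) = - ur M"
    "ul (0 :: 'a upper2) = 0" "lr (0 :: 'a upper2) = 0" "ur (0 :: 'a upper2) = 0"
    "ul (1 :: 'a upper2) = 1" "lr (1 :: 'a upper2) = 1" "ur (1 :: 'a upper2) = 0"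
  by (simp_all add: ul_def ur_def lr_def times_upper2.rep_eq plus_upper2.rep_eq
      minus_upper2.rep_eq uminus_upper2.rep_eq zero_upper2.rep_eq one_upper2.rep_eq
      matrix_matrix_mult_def sum_2 upper2_lower_left mat_def)

context scalar_action
begin

lemma upper2_scale_entries [simp]:
  "ul (upper2_scale smul c M) = smul c (ul M)" "ur (upper2_scale smul c M) = smul c (ur M)"
  "lr (upper2_scale smul c M) = smul c (lr M)"
  by (simp_all add: ul_def ur_def lr_def upper2_matrix_scale)

lemma scalar_action_upper2: "scalar_action (upper2_scale smul)"
  by standard (simp_all add: upper2_eq_iff smul_add_right smul_add_left smul_smul smul_one
      smul_mult_left smul_mult_right)

interpretation upper: scalar_action "upper2_scale smul"
  by (rule scalar_action_upper2)

lemma diag_eval: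
  "ul (eval_poly (upper2_scale smul) M f) = eval_poly smul (\<lambda>i. ul (M i)) f"
  "lr (eval_poly (upper2_scale smul) M f) = eval_poly smul (\<lambda>i. lr (M i)) f"
proof -
  have 1: "ul (prod_list (map M w)) = prod_list (map (\<lambda>i. ul (M i)) w)"
    "lr (prod_list (map M w)) = prod_list (map (\<lambda>i. lr (M i)) w)" for w
    by (induction w) simp_all
  show "ul (eval_poly (upper2_scale smul) M f) = eval_poly smul (\<lambda>i. ul (M i)) f"
    by (induction f rule: poly_mapping_single_induct) (simp_all add: 1)
  show "lr (eval_poly (upper2_scale smul) M f) = eval_poly smul (\<lambda>i. lr (M i)) f"
    by (induction f rule: poly_mapping_single_induct) (simp_all add: 1)
qed

text \<open>
  The upper right entry as a function of the free algebra is a derivation twisted by the two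
  diagonals (\<open>cross_mult\<close>). All separation arguments below work with this entry.
\<close>

definition cross :: "(nat \<Rightarrow> 'a) \<Rightarrow> (nat \<Rightarrow> 'a) \<Rightarrow> (nat \<Rightarrow> 'a) \<Rightarrow> 'k free_alg \<Rightarrow> 'a"
  where "cross a m b f = ur (eval_poly (upper2_scale smul) (\<lambda>i. tri (a i) (m i) (b i)) f)"

lemma cross_add [simp]: "cross a m b (f + g) = cross a m b f + cross a m b g"
  and cross_diff [simp]: "cross a m b (f - g) = cross a m b f - cross a m b g"
  and cross_uminus [simp]: "cross a m b (- f) = - cross a m b f"
  and cross_zero [simp]: "cross a m b 0 = 0"
  and cross_mult: "cross a m b (f * g) =
    eval_poly smul a f * cross a m b g + cross a m b f * eval_poly smul b g"
  by (simp_all add: cross_def diag_eval)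

lemma cross_sum: "cross a m b (sum f A) = (\<Sum>x\<in>A. cross a m b (f x))"
  by (induction A rule: infinite_finite_induct) simp_all

end

lemma identity_entries:
  assumes "\<forall>i. a i \<in> R" "\<forall>i. m i \<in> R" "\<forall>i. b i \<in> R" "0 \<in> R"
    and "f \<in> polynomial_identities (upper2_scale grassmann_scale) (UT2 (R :: 'k::field grassmann set))"
  shows "gr.cross a m b f = 0" "eval_poly grassmann_scale a f = 0"
proof -
  have "tri (a i) (m i) (b i) \<in> UT2 R" for i
    using assms(1-4) by (simp add: UT2_def tri.rep_eq)
  then have 0: "eval_poly (upper2_scale grassmann_scale) (\<lambda>i. tri (a i) (m i) (b i)) f = 0"
    using assms(5) by (simp add: polynomial_identities_def)
  then show "gr.cross a m b f = 0"
    by (simp add: gr.cross_def)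
  show "eval_poly grassmann_scale a f = 0"
    using gr.diag_eval(1)[of "\<lambda>i. tri (a i) (m i) (b i)" f] 0 by simp
qed

section \<open>T-ideals\<close>

text \<open>
  Constants and variables generate the free algebra. Arguments about endomorphisms, subalgebras and
  twisted derivations need no formulas for monomials when they use this induction.
\<close>

lemma free_alg_induct [case_names const var add mult]:
  fixes f :: "'k::field free_alg"
  assumes const: "\<And>c. P (Poly_Mapping.single 0 c)" and var: "\<And>i. P (var i)"
    and add: "\<And>f g. P f \<Longrightarrow> P g \<Longrightarrow> P (f + g)" and mult: "\<And>f g. P f \<Longrightarrow> P g \<Longrightarrow> P (f * g)"
  shows "P f"
proof (induction f rule: poly_mapping_single_induct)
  case zero
  show ?case using const[of 0] by simp
next
  case (single w c)
  have "P (Poly_Mapping.single (Monomial xs) c)" for xs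
  proof (induction xs)
    case Nil
    show ?case using const[of c] by (simp add: zero_monomial_def)
  next
    case (Cons x xs)
    have "Poly_Mapping.single (Monomial (x # xs)) c = var x * Poly_Mapping.single (Monomial xs) c"
      by (simp add: var_def mult_single plus_monomial_def)
    then show ?case using mult[OF var Cons] by simp
  qed
  then show ?case by (cases w) auto
qed (rule add)

lemma (in scalar_action) eval_in_subalgebra:
  assumes "\<And>c. smul c 1 \<in> A" "\<And>x y. x \<in> A \<Longrightarrow> y \<in> A \<Longrightarrow> x + y \<in> A"
    and "\<And>x y. x \<in> A \<Longrightarrow> y \<in> A \<Longrightarrow> x * y \<in> A" and "\<And>i. a i \<in> A"
  shows "eval_poly smul a f \<in> A"
  by (induction f rule: free_alg_induct) (simp_all add: assms)

text \<open>
  Both sides are homomorphisms that agree on the variables. The equation is unsuitable as a rewrite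
  rule, since its right-hand side contains an instance of its left-hand side.
\<close>

lemma (in scalar_action) eval_endomorphism:
  assumes "free_endomorphism \<phi>"
  shows "eval_poly smul a (\<phi> f) = eval_poly smul (\<lambda>i. eval_poly smul a (\<phi> (var i))) f"
proof (induction f rule: free_alg_induct)
  case (const c)
  have "\<phi> (free_scale c 1) = free_scale c 1"
    using assms by (simp add: free_endomorphism_def)
  then show ?case by (simp add: free_scale_eq_mult)
qed (use assms in \<open>simp_all add: free_endomorphism_def\<close>)

lemma (in scalar_action) T_ideal_polynomial_identities:
  assumes "\<And>c. smul c 1 \<in> A" "\<And>x y. x \<in> A \<Longrightarrow> y \<in> A \<Longrightarrow> x + y \<in> A"
    and "\<And>x y. x \<in> A \<Longrightarrow> y \<in> A \<Longrightarrow> x * y \<in> A"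
  shows "T_ideal (polynomial_identities smul A)"
  unfolding T_ideal_def
proof (intro conjI allI impI subsetI)
  show "two_sided_ideal (polynomial_identities smul A)"
    by (auto simp: two_sided_ideal_def polynomial_identities_def)
next
  fix \<phi> g
  assume endo: "free_endomorphism \<phi>" and "g \<in> \<phi> ` polynomial_identities smul A"
  then obtain f where f: "g = \<phi> f" "f \<in> polynomial_identities smul A"
    by blast
  have "eval_poly smul a g = 0" if "\<forall>i. a i \<in> A" for a
  proof -
    have "eval_poly smul a (\<phi> (var i)) \<in> A" for i
      using that by (intro eval_in_subalgebra assms) auto
    then have "eval_poly smul (\<lambda>i. eval_poly smul a (\<phi> (var i))) f = 0"
      using f(2) by (simp add: polynomial_identities_def)
    then show ?thesis
      using eval_endomorphism[OF endo, of a f] f(1) by argo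
  qed
  then show "g \<in> polynomial_identities smul A"
    by (simp add: polynomial_identities_def)
qed

lemma free_endomorphism_subst:
  "free_endomorphism (eval_poly free_scale (a :: nat \<Rightarrow> 'k::field free_alg))"
  by (simp add: free_endomorphism_def free_scale_eq_mult)

lemma T_ideal_hull: "T_ideal (T_ideal hull S)"
proof (rule hull_in)
  fix \<F> :: "'a free_alg set set"
  assume T: "Ball \<F> T_ideal"
  then have "two_sided_ideal (\<Inter>\<F>)"
    by (simp add: T_ideal_def two_sided_ideal_def)
  moreover have "\<phi> ` \<Inter>\<F> \<subseteq> \<Inter>\<F>" if "free_endomorphism \<phi>" for \<phi>
  proof (rule image_subsetI)
    fix f
    assume f: "f \<in> \<Inter>\<F>"
    have "\<phi> f \<in> I" if "I \<in> \<F>" for I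
    proof -
      have "\<phi> ` I \<subseteq> I"
        using T \<open>free_endomorphism \<phi>\<close> \<open>I \<in> \<F>\<close> unfolding T_ideal_def by (metis (no_types))
      then show ?thesis using f \<open>I \<in> \<F>\<close> by (meson InterD image_subset_iff)
    qed
    then show "\<phi> f \<in> \<Inter>\<F>" by (rule InterI)
  qed
  ultimately show "T_ideal (\<Inter>\<F>)"
    by (simp add: T_ideal_def)
qed

lemma T_ideal_subst:
  assumes "T_ideal J" "f \<in> J"
  shows "eval_poly free_scale a f \<in> J"
proof -
  have "eval_poly free_scale a ` J \<subseteq> J"
    using assms(1) free_endomorphism_subst[of a] unfolding T_ideal_def by (elim conjE allE impE)
  with assms(2) show ?thesis by (simp add: image_subset_iff)
qed

lemma two_sided_ideal_hull: "two_sided_ideal (two_sided_ideal hull S)"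
  by (rule hull_in) (simp add: two_sided_ideal_def)

section \<open>Ideals generated by commutators\<close>

lemma two_sided_idealD:
  assumes "two_sided_ideal I"
  shows "0 \<in> I" "f \<in> I \<Longrightarrow> g \<in> I \<Longrightarrow> f + g \<in> I" "f \<in> I \<Longrightarrow> h * f \<in> I" "f \<in> I \<Longrightarrow> f * h \<in> I"
    "f \<in> I \<Longrightarrow> - f \<in> I" "f \<in> I \<Longrightarrow> g \<in> I \<Longrightarrow> f - g \<in> I"
proof -
  have m: "- f \<in> I" if "f \<in> I" for f
    using assms that mult_minus1[of f] unfolding two_sided_ideal_def by metis
  show "0 \<in> I" "f \<in> I \<Longrightarrow> g \<in> I \<Longrightarrow> f + g \<in> I" "f \<in> I \<Longrightarrow> h * f \<in> I" "f \<in> I \<Longrightarrow> f * h \<in> I"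
    using assms by (auto simp: two_sided_ideal_def)
  show "f \<in> I \<Longrightarrow> - f \<in> I" by (rule m)
  show "f \<in> I \<Longrightarrow> g \<in> I \<Longrightarrow> f - g \<in> I"
    using assms m[of g] by (auto simp: two_sided_ideal_def simp del: add_uminus_conv_diff
        simp flip: add_uminus_conv_diff)
qed

lemma commutator_mult_right:
  "commutator a (b * c) = commutator a b * c + b * commutator a (c :: 'a::ring)"
  by (simp add: commutator_def algebra_simps)

lemma commutator_mult_left:
  "commutator (a * b) c = commutator a c * b + a * commutator b (c :: 'a::ring)"
  by (simp add: commutator_def algebra_simps)

lemma commutator_add:
  "commutator (a + b) c = commutator a c + commutator b (c :: 'a::ring)"
  "commutator c (a + b) = commutator c a + commutator c b"
  by (simp_all add: commutator_def algebra_simps)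

lemma commutator_swap: "commutator a b = - commutator b (a :: 'a::ring)"
  by (simp add: commutator_def)

text \<open>
  Only the second entry of the generating commutators ranges over the whole ring. This is all that
  moving a factor across a commutator requires, so that both ideals below can be treated alike.
\<close>

definition commutator_ideal :: "'a::ring_1 set \<Rightarrow> 'a set"
  where "commutator_ideal B = two_sided_ideal hull {commutator b h |b h. b \<in> B}"

definition comm_ideal :: "'a::ring_1 set"
  where "comm_ideal = commutator_ideal UNIV"

definition triple_ideal :: "'a::ring_1 set"
  where "triple_ideal = commutator_ideal {commutator f g |f g. True}"

lemma comm_ideal: "two_sided_ideal comm_ideal"
  unfolding comm_ideal_def commutator_ideal_def by (rule two_sided_ideal_hull)

lemma triple_ideal: "two_sided_ideal triple_ideal"
  unfolding triple_ideal_def commutator_ideal_def by (rule two_sided_ideal_hull)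

lemmas comm_idealD = two_sided_idealD[OF comm_ideal]
lemmas triple_idealD = two_sided_idealD[OF triple_ideal]

lemma commutator_in_comm_ideal: "commutator f g \<in> comm_ideal"
  unfolding comm_ideal_def commutator_ideal_def by (rule hull_inc) auto

lemma triple_commutator_in_triple_ideal: "commutator (commutator f g) h \<in> triple_ideal"
  unfolding triple_ideal_def commutator_ideal_def by (rule hull_inc) auto

lemma comm_ideal_minimal:
  "two_sided_ideal I \<Longrightarrow> (\<And>f g. commutator f g \<in> I) \<Longrightarrow> comm_ideal \<subseteq> I"
  unfolding comm_ideal_def commutator_ideal_def by (rule hull_minimal) auto

lemma triple_ideal_minimal:
  "two_sided_ideal I \<Longrightarrow> (\<And>f g h. commutator (commutator f g) h \<in> I) \<Longrightarrow> triple_ideal \<subseteq> I"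
  unfolding triple_ideal_def commutator_ideal_def by (rule hull_minimal) auto

lemma triple_ideal_subset_comm_ideal: "triple_ideal \<subseteq> comm_ideal"
  by (rule triple_ideal_minimal[OF comm_ideal commutator_in_comm_ideal])

text \<open>
  The identity \<open>[b, h] v = [b, h v] - h [b, v]\<close> moves a right factor \<open>v\<close> into the commutator, at
  the price of a left factor \<open>h\<close> that the right ideal \<open>Z\<close> swallows. So the factor \<open>y\<close> can stay
  fixed while a hypothesis on commutators is extended to the ideal that they generate.
\<close>

lemma absorb_commutators:
  fixes J :: "'a::ring_1 set"
  assumes J: "two_sided_ideal J" and Z: "\<And>z v. z \<in> Z \<Longrightarrow> z * v \<in> Z"
    and gen: "\<And>z b h. z \<in> Z \<Longrightarrow> b \<in> B \<Longrightarrow> z * commutator b h * y \<in> J"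
    and c: "c \<in> commutator_ideal B" and z: "z \<in> Z"
  shows "z * c * y \<in> J"
proof -
  note J' = two_sided_idealD[OF J]
  define I where "I = {c. \<forall>z\<in>Z. \<forall>v. z * c * v * y \<in> J}"
  have "two_sided_ideal I"
    unfolding two_sided_ideal_def
  proof (intro conjI ballI allI)
    show "0 \<in> I" by (simp add: I_def J')
    show "f + g \<in> I" if "f \<in> I" "g \<in> I" for f g
      using that by (simp add: I_def J' distrib_left distrib_right)
    show "g * f \<in> I" if "f \<in> I" for f g
    proof -
      have "z * g * f * v * y \<in> J" if "z \<in> Z" for z v
        using \<open>f \<in> I\<close> Z[OF that, of g] by (auto simp: I_def)
      then show ?thesis by (simp add: I_def mult.assoc)
    qed
    show "f * g \<in> I" if "f \<in> I" for f g
    proof -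
      have "z * f * (g * v) * y \<in> J" if "z \<in> Z" for z v
        using \<open>f \<in> I\<close> that by (auto simp: I_def)
      then show ?thesis by (simp add: I_def mult.assoc)
    qed
  qed
  moreover have "{commutator b h |b h. b \<in> B} \<subseteq> I"
  proof (clarsimp simp: I_def)
    fix b h z v
    assume "b \<in> B" "z \<in> Z"
    then have "z * commutator b (h * v) * y - z * h * commutator b v * y \<in> J"
      by (intro J'(6) gen Z)
    then show "z * commutator b h * v * y \<in> J"
      by (simp add: commutator_mult_right algebra_simps)
  qed
  ultimately have "c \<in> I"
    using c hull_minimal[of "{commutator b h |b h. b \<in> B}" I two_sided_ideal]
    unfolding commutator_ideal_def by blast
  with z have "z * c * 1 * y \<in> J" unfolding I_def by blast
  then show ?thesis by simp
qed

lemma triple_products_in_T_ideal: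
  fixes J :: "'k::field free_alg set"
  assumes J: "T_ideal J"
    and gen: "commutator (commutator (var 0) (var 1)) (var 2) *
      commutator (commutator (var 3) (var 4)) (var 5) \<in> J"
    and "s \<in> triple_ideal" "t \<in> triple_ideal"
  shows "s * t \<in> J"
proof -
  have J': "two_sided_ideal J" using J by (simp add: T_ideal_def)
  have 1: "commutator (commutator f g) h * commutator (commutator f' g') h' \<in> J" for f g h f' g' h'
    using T_ideal_subst[OF J gen, of "\<lambda>i. [f, g, h, f', g', h'] ! i"]
    by (simp add: numeral_eq_Suc)
  have 2: "c * commutator (commutator f' g') h' \<in> J" if "c \<in> triple_ideal" for c f' g' h'
  proof -
    have "1 * c * commutator (commutator f' g') h' \<in> J"
    proof (rule absorb_commutators[OF J', of UNIV "{commutator f g |f g. True}"])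
      show "z * commutator b h * commutator (commutator f' g') h' \<in> J"
        if "b \<in> {commutator f g |f g. True}" for z b h
        using that two_sided_idealD(3)[OF J' 1] by (auto simp: mult.assoc)
      show "c \<in> commutator_ideal {commutator f g |f g. True}"
        using that unfolding triple_ideal_def .
    qed auto
    then show ?thesis by simp
  qed
  have "s * t * 1 \<in> J"
  proof (rule absorb_commutators[OF J', of triple_ideal "{commutator f g |f g. True}"])
    show "z * commutator b h * 1 \<in> J"
      if "z \<in> triple_ideal" "b \<in> {commutator f g |f g. True}" for z b h
      using that 2 by auto
    show "t \<in> commutator_ideal {commutator f g |f g. True}"
      using assms(4) unfolding triple_ideal_def .
  qed (rule triple_idealD(4) assms(3) | assumption)+
  then show ?thesis by simp
qed

text \<open>
  The commutators in the product are replaced by elements of the ideal from left to right; the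
  products of the elements already placed then serve as the set \<open>Z\<close> of
  \<open>absorb_commutators\<close>.
\<close>

lemma commutator_products_in_T_ideal:
  fixes J :: "'k::field free_alg set"
  assumes J: "T_ideal J"
    and gen: "(\<Prod>i\<leftarrow>[0..<n]. commutator (var (2 * i)) (var (2 * i + 1))) \<in> J"
    and "set cs \<subseteq> comm_ideal" "length cs = n"
  shows "prod_list cs \<in> J"
proof -
  have J': "two_sided_ideal J" using J by (simp add: T_ideal_def)
  have gens: "(\<Prod>(f, g)\<leftarrow>ds. commutator f g) \<in> J" if "length ds = n" for ds
  proof -
    \<comment> \<open>The generator pairs up the variables \<open>2 i\<close> and \<open>2 i + 1\<close>, so these must become the entries of
      the commutator number \<open>i\<close>.\<close>
    define a where "a k = (if even k then fst (ds ! (k div 2)) else snd (ds ! (k div 2)))" for k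
    have "map (\<lambda>(f, g). commutator f g) ds
        = map (\<lambda>i. case ds ! i of (f, g) \<Rightarrow> commutator f g) [0..<n]"
      using that by (intro nth_equalityI) simp_all
    then have "(\<Prod>(f, g)\<leftarrow>ds. commutator f g)
        = (\<Prod>i\<leftarrow>[0..<n]. commutator (a (2 * i)) (a (2 * i + 1)))"
      by (simp add: a_def case_prod_unfold)
    then show ?thesis
      using T_ideal_subst[OF J gen, of a] by (simp add: free.eval_prod_list comp_def)
  qed
  have "prod_list cs * (\<Prod>(f, g)\<leftarrow>ds. commutator f g) \<in> J"
    if "set cs \<subseteq> comm_ideal" "length cs = k" "k + length ds = n" for k cs ds
    using that
  proof (induction k arbitrary: cs ds)
    case 0
    then show ?case using gens by simp
  next
    case (Suc k)
    then obtain bs c where cs: "cs = bs @ [c]"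
      by (metis append_butlast_last_id length_0_conv nat.distinct(1))
    let ?y = "\<Prod>(f, g)\<leftarrow>ds. commutator f g"
    let ?Z = "{prod_list zs * v |zs v. set zs \<subseteq> comm_ideal \<and> length zs = k}"
    have "prod_list bs * c * ?y \<in> J"
    proof (rule absorb_commutators[OF J', of ?Z UNIV])
      show "z * v \<in> ?Z" if z: "z \<in> ?Z" for z v
      proof -
        from z obtain zs w where "z = prod_list zs * w" "set zs \<subseteq> comm_ideal" "length zs = k"
          by blast
        then show ?thesis by (auto simp: mult.assoc)
      qed
      show "z * commutator b h * ?y \<in> J" if z: "z \<in> ?Z" for z b h
      proof -
        from z obtain zs v where v: "z = prod_list zs * v" "set zs \<subseteq> comm_ideal" "length zs = k"
          by blast
        show ?thesis
        proof (cases zs rule: rev_cases)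
          case Nil
          have "commutator b h * ?y \<in> J"
            using gens[of "(b, h) # ds"] Suc.prems v Nil by simp
          then show ?thesis using v Nil two_sided_idealD(3)[OF J'] by (simp add: mult.assoc)
        next
          case (snoc us u)
          have "prod_list (us @ [u * v]) * (\<Prod>(f, g)\<leftarrow>(b, h) # ds. commutator f g) \<in> J"
            using v snoc Suc.prems by (intro Suc.IH) (auto simp: comm_idealD)
          then show ?thesis using v snoc by (simp add: mult.assoc)
        qed
      qed
      show "c \<in> commutator_ideal UNIV"
        using Suc.prems cs by (simp add: comm_ideal_def)
      have "prod_list bs * 1 \<in> ?Z"
        using Suc.prems cs by (intro CollectI exI[of _ bs] exI[of _ 1]) simp
      then show "prod_list bs \<in> ?Z" by simp
    qed
    then show ?case using cs by (simp add: mult.assoc)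
  qed
  from this[of cs n "[]"] show ?thesis using assms by simp
qed

section \<open>Sums indexed by pairs of variables\<close>

definition add_subgroup :: "'a::ab_group_add set \<Rightarrow> bool"
  where "add_subgroup H \<longleftrightarrow> 0 \<in> H \<and> (\<forall>x\<in>H. \<forall>y\<in>H. x - y \<in> H)"

lemma add_subgroupD:
  assumes "add_subgroup H"
  shows "0 \<in> H" "x \<in> H \<Longrightarrow> y \<in> H \<Longrightarrow> x - y \<in> H" "x \<in> H \<Longrightarrow> - x \<in> H"
    "x \<in> H \<Longrightarrow> y \<in> H \<Longrightarrow> x + y \<in> H"
proof -
  have m: "- x \<in> H" if "x \<in> H" for x
    using assms that diff_0[of x] unfolding add_subgroup_def by metis
  show "0 \<in> H" "x \<in> H \<Longrightarrow> y \<in> H \<Longrightarrow> x - y \<in> H" "x \<in> H \<Longrightarrow> - x \<in> H"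
    using assms m by (auto simp: add_subgroup_def)
  show "x \<in> H \<Longrightarrow> y \<in> H \<Longrightarrow> x + y \<in> H"
    using assms m[of y] diff_minus_eq_add[of x y] unfolding add_subgroup_def by metis
qed

lemma add_subgroup_sum:
  assumes "add_subgroup H" "\<And>i. i \<in> A \<Longrightarrow> f i \<in> H"
  shows "sum f A \<in> H"
  using assms(2)
  by (induction A rule: infinite_finite_induct) (simp_all add: add_subgroupD[OF assms(1)])

lemma add_subgroup_two_sided_ideal: "two_sided_ideal I \<Longrightarrow> add_subgroup I"
  by (auto simp: add_subgroup_def two_sided_idealD)

lemma add_subgroup_set_plus:
  assumes "add_subgroup H" "add_subgroup K"
  shows "add_subgroup (H + K)"
  unfolding add_subgroup_def
proof (intro conjI ballI)
  show "0 \<in> H + K"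
    using set_plus_intro[of 0 H 0 K] assms by (simp add: add_subgroupD)
  fix x y
  assume "x \<in> H + K" "y \<in> H + K"
  then obtain a b c d where "x = a + b" "y = c + d" "a \<in> H" "b \<in> K" "c \<in> H" "d \<in> K"
    by (auto elim!: set_plus_elim)
  then have "x - y = (a - c) + (b - d)" "a - c \<in> H" "b - d \<in> K"
    using assms by (auto simp: add_subgroupD)
  then show "x - y \<in> H + K" by (metis set_plus_intro)
qed

lemma set_plus_left: "add_subgroup K \<Longrightarrow> x \<in> H \<Longrightarrow> x \<in> H + K"
  using set_plus_intro[of x H 0 K] by (simp add: add_subgroupD)

lemma set_plus_right: "add_subgroup H \<Longrightarrow> x \<in> K \<Longrightarrow> x \<in> H + K"
  using set_plus_intro[of 0 H x K] by (simp add: add_subgroupD)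

lemma set_plus_subset:
  assumes "add_subgroup L" "H \<subseteq> L" "K \<subseteq> L"
  shows "H + K \<subseteq> L"
proof
  fix x
  assume "x \<in> H + K"
  then obtain a b where "x = a + b" "a \<in> H" "b \<in> K"
    by (rule set_plus_elim)
  with assms show "x \<in> L" by (simp add: add_subgroupD(4) subset_iff)
qed

text \<open>
  For additive \<open>h i\<close> and a group \<open>X\<close> this is the sum of the groups \<open>h i ` X\<close>. The coefficient function is total,
  with values in \<open>X\<close>, so that it can be used without reference to the finite index set.
\<close>

definition combos :: "'i set \<Rightarrow> ('i \<Rightarrow> 'a \<Rightarrow> 'b::ab_group_add) \<Rightarrow> 'a set \<Rightarrow> 'b set"
  where "combos I h X = {\<Sum>i\<in>A. h i (c i) |A c. finite A \<and> A \<subseteq> I \<and> (\<forall>i. c i \<in> X)}"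

lemma combosI: "i \<in> I \<Longrightarrow> x \<in> X \<Longrightarrow> h i x \<in> combos I h X"
  unfolding combos_def by (intro CollectI exI[of _ "{i}"] exI[of _ "\<lambda>_. x"]) simp

lemma combosE:
  assumes "x \<in> combos I h X"
  obtains A c where "finite A" "A \<subseteq> I" "\<And>i. c i \<in> X" "x = (\<Sum>i\<in>A. h i (c i))"
  using assms unfolding combos_def by blast

lemma combos_subset:
  assumes "add_subgroup H" "\<And>i x. i \<in> I \<Longrightarrow> x \<in> X \<Longrightarrow> h i x \<in> H"
  shows "combos I h X \<subseteq> H"
  using assms by (auto simp: combos_def intro!: add_subgroup_sum)

lemma add_subgroup_combos:
  fixes h :: "'i \<Rightarrow> 'a::ab_group_add \<Rightarrow> 'b::ab_group_add"
  assumes X: "add_subgroup X" and h: "\<And>i x y. h i (x - y) = h i x - h i y"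
  shows "add_subgroup (combos I h X)"
  unfolding add_subgroup_def
proof (intro conjI ballI)
  have h0: "h i 0 = 0" for i
    using h[of i 0 0] by simp
  show "0 \<in> combos I h X"
    unfolding combos_def using add_subgroupD(1)[OF X]
    by (intro CollectI exI[of _ "{}"] exI[of _ "\<lambda>_. 0"]) simp
  fix x y
  assume "x \<in> combos I h X" "y \<in> combos I h X"
  then obtain A c B d where A: "finite A" "A \<subseteq> I" "\<And>i. c i \<in> X" "x = (\<Sum>i\<in>A. h i (c i))"
    and B: "finite B" "B \<subseteq> I" "\<And>i. d i \<in> X" "y = (\<Sum>i\<in>B. h i (d i))"
    by (elim combosE) blast
  have 1: "x = (\<Sum>i\<in>A \<union> B. h i (if i \<in> A then c i else 0))"
    unfolding A(4) using A(1) B(1) by (intro sum.mono_neutral_cong_left) (auto simp: h0)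
  have 2: "y = (\<Sum>i\<in>A \<union> B. h i (if i \<in> B then d i else 0))"
    unfolding B(4) using A(1) B(1) by (intro sum.mono_neutral_cong_left) (auto simp: h0)
  have "x - y = (\<Sum>i\<in>A \<union> B. h i ((if i \<in> A then c i else 0) - (if i \<in> B then d i else 0)))"
    unfolding 1 2 h sum_subtractf ..
  then show "x - y \<in> combos I h X"
    unfolding combos_def using A B add_subgroupD[OF X]
    by (intro CollectI exI[of _ "A \<union> B"]
        exI[of _ "\<lambda>i. (if i \<in> A then c i else 0) - (if i \<in> B then d i else 0)"]) auto
qed

definition com :: "nat \<times> nat \<Rightarrow> 'k::field free_alg"
  where "com p = commutator (var (fst p)) (var (snd p))"

definition pairs :: "(nat \<times> nat) set"
  where "pairs = {(i, j). i < j}"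

text \<open>
  Modulo \<open>L\<close> the variables commute, and the variables and the central constants generate the free
  algebra, so the quotient is commutative.
\<close>

lemma commutators_from_variables:
  fixes L :: "'k::field free_alg set"
  assumes L: "two_sided_ideal L" and gen: "\<And>p. p \<in> pairs \<Longrightarrow> com p \<in> L"
  shows "commutator f g \<in> L"
proof -
  note L' = two_sided_idealD[OF L]
  have const: "commutator (Poly_Mapping.single 0 c) h = 0" "commutator h (Poly_Mapping.single 0 c) = 0"
    for c and h :: "'k free_alg"
    by (simp_all add: commutator_def single_zero_commutes)
  have vars: "commutator (var i) (var j :: 'k free_alg) \<in> L" for i j
  proof (cases i j rule: linorder_cases)
    case less
    then show ?thesis using gen[of "(i, j)"] by (simp add: com_def pairs_def)
  next
    case equal
    then show ?thesis by (simp add: commutator_def L')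
  next
    case greater
    then show ?thesis
      using gen[of "(j, i)"] L'(5) by (subst commutator_swap) (simp add: com_def pairs_def)
  qed
  have "commutator (var i) g \<in> L" for i
    by (induction g rule: free_alg_induct)
      (simp_all add: const vars commutator_add commutator_mult_right L')
  then show ?thesis
    by (induction f rule: free_alg_induct)
      (simp_all add: const commutator_add commutator_mult_left L')
qed

text \<open>
  Commutators of variables are central modulo \<open>triple_ideal\<close>, so the right-hand side is a
  two-sided ideal, and it contains the commutators of variables.
\<close>

lemma comm_ideal_decomp_left:
  "(comm_ideal :: 'k::field free_alg set) \<subseteq> triple_ideal + combos pairs (\<lambda>p u. u * com p) UNIV"
    (is "_ \<subseteq> _ + ?S")
proof -
  let ?L = "triple_ideal + ?S"
  have S: "add_subgroup ?S"
    by (rule add_subgroup_combos) (simp_all add: add_subgroup_def algebra_simps)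
  note T = add_subgroup_two_sided_ideal[OF triple_ideal]
  note L = add_subgroup_set_plus[OF T S]
  have left: "g * s \<in> ?S" if "s \<in> ?S" for g s
  proof -
    have "?S \<subseteq> {s. g * s \<in> ?S}"
    proof (rule combos_subset)
      show "add_subgroup {s. g * s \<in> ?S}"
        using add_subgroupD[OF S] by (simp add: add_subgroup_def algebra_simps)
      show "u * com p \<in> {s. g * s \<in> ?S}" if "p \<in> pairs" for p u
        using combosI[OF that, of "g * u" UNIV "\<lambda>p u. u * com p"] by (simp add: mult.assoc)
    qed
    with that show ?thesis by blast
  qed
  have right: "s * g \<in> ?L" if "s \<in> ?S" for g s
  proof -
    have "?S \<subseteq> {s. s * g \<in> ?L}"
    proof (rule combos_subset)
      show "add_subgroup {s. s * g \<in> ?L}"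
        using add_subgroupD[OF L] by (simp add: add_subgroup_def algebra_simps)
      show "u * com p \<in> {s. s * g \<in> ?L}" if "p \<in> pairs" for p u
      proof -
        have "u * com p * g = u * commutator (com p) g + u * g * com p"
          by (simp add: commutator_def algebra_simps)
        moreover have "u * commutator (com p) g \<in> triple_ideal"
          unfolding com_def by (intro triple_idealD triple_commutator_in_triple_ideal)
        ultimately show ?thesis
          using combosI[OF that, of "u * g" UNIV "\<lambda>p u. u * com p"] by auto
      qed
    qed
    with that show ?thesis by blast
  qed
  have ideal: "two_sided_ideal ?L"
    unfolding two_sided_ideal_def
  proof (intro conjI ballI allI)
    show "0 \<in> ?L"
      using add_subgroupD[OF L] by simp
    show "f + g \<in> ?L" if "f \<in> ?L" "g \<in> ?L" for f g
      using that add_subgroupD[OF L] by simp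
    fix f g
    assume "f \<in> ?L"
    then obtain t s where f: "f = t + s" "t \<in> triple_ideal" "s \<in> ?S"
      by (auto elim!: set_plus_elim)
    show "g * f \<in> ?L"
      using f left by (auto simp: distrib_left triple_idealD)
    have "t * g \<in> ?L"
      using f by (intro set_plus_left S triple_idealD)
    then show "f * g \<in> ?L"
      using right[OF f(3), of g] by (simp add: f(1) distrib_right add_subgroupD[OF L])
  qed
  have "com p \<in> ?L" if "p \<in> pairs" for p
    using combosI[OF that, of 1 UNIV "\<lambda>p u. u * com p"] by (intro set_plus_right T) simp
  then show ?thesis
    by (intro comm_ideal_minimal ideal commutators_from_variables)
qed

lemma comm_ideal_decomp_right:
  "(comm_ideal :: 'k::field free_alg set) \<subseteq> triple_ideal + combos pairs (\<lambda>p u. com p * u) UNIV"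
    (is "_ \<subseteq> _ + ?S")
proof -
  have S: "add_subgroup ?S"
    by (rule add_subgroup_combos) (simp_all add: add_subgroup_def algebra_simps)
  note T = add_subgroup_two_sided_ideal[OF triple_ideal]
  note L = add_subgroup_set_plus[OF T S]
  have "combos pairs (\<lambda>p u. u * com p) (UNIV :: 'k free_alg set) \<subseteq> triple_ideal + ?S"
  proof (rule combos_subset[OF L])
    fix p and u :: "'k free_alg" assume p: "p \<in> pairs"
    have eq: "u * com p = - commutator (com p) u + com p * u"
      by (simp add: commutator_def algebra_simps)
    have "- commutator (com p) u \<in> triple_ideal"
      unfolding com_def by (intro triple_idealD triple_commutator_in_triple_ideal)
    moreover have "com p * u \<in> ?S"
      using combosI[OF p, of u UNIV "\<lambda>p u. com p * u"] by simp
    ultimately show "u * com p \<in> triple_ideal + ?S"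
      unfolding eq by (rule set_plus_intro)
  qed
  moreover have "triple_ideal \<subseteq> triple_ideal + ?S"
    using set_plus_left[OF S] by blast
  ultimately show ?thesis
    by (intro order_trans[OF comm_ideal_decomp_left] set_plus_subset[OF L])
qed

section \<open>Upper triangular matrices over the field\<close>

text \<open>
  Dedekind's argument: evaluating a relation at \<open>mul x y\<close> and subtracting \<open>E k y\<close> times the
  relation at \<open>x\<close> removes the character \<open>E k\<close> and scales each other coefficient by
  \<open>E l y - E k y\<close>.
\<close>

lemma characters_independent:
  fixes E :: "'l \<Rightarrow> 'x \<Rightarrow> 'k::field"
  assumes "finite L" and mul: "\<And>l x y. E l (mul x y) = E l x * E l y"
    and nonzero: "\<And>l. \<exists>x. E l x \<noteq> 0" and distinct: "\<And>l l'. l \<noteq> l' \<Longrightarrow> \<exists>x. E l x \<noteq> E l' x"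
    and zero: "\<And>x. (\<Sum>l\<in>L. g l * E l x) = 0" and "l \<in> L"
  shows "g l = 0"
  using assms(1) zero \<open>l \<in> L\<close>
proof (induction L arbitrary: g l)
  case (insert k L)
  have other: "g l = 0" if l: "l \<in> L" for l
  proof -
    obtain y where y: "E l y \<noteq> E k y"
      using distinct[of l k] insert.hyps l by blast
    have "(\<Sum>l\<in>L. g l * (E l y - E k y) * E l x) = 0" for x
    proof -
      have "(\<Sum>l\<in>insert k L. g l * E l (mul x y)) - (\<Sum>l\<in>insert k L. g l * E l x) * E k y = 0"
        using insert.prems(1) by simp
      then have "(\<Sum>l\<in>L. g l * (E l x * E l y)) - (\<Sum>l\<in>L. g l * E l x) * E k y = 0"
        using insert.hyps by (simp add: mul algebra_simps)
      moreover have "(\<Sum>l\<in>L. g l * (E l y - E k y) * E l x)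
          = (\<Sum>l\<in>L. g l * (E l x * E l y)) - (\<Sum>l\<in>L. g l * E l x) * E k y"
        unfolding sum_distrib_right sum_subtractf[symmetric]
        by (intro sum.cong refl) (simp add: algebra_simps)
      ultimately show ?thesis by simp
    qed
    then have "g l * (E l y - E k y) = 0"
      using insert.IH[of "\<lambda>l. g l * (E l y - E k y)"] l by blast
    with y show ?thesis by simp
  qed
  have "g k * E k x = 0" for x
    using insert.prems(1)[of x] insert.hyps other by simp
  then have "g k = 0" using nonzero[of k] by auto
  with other insert.prems(2) show ?case by auto
qed simp

text \<open>
  A vanishing combination of characters still vanishes when each character is replaced by an
  arbitrary vector that depends only on it.
\<close>

lemma (in scalar_action) characters_separate:
  fixes E :: "'l \<Rightarrow> 'x \<Rightarrow> 'k"
  assumes fin: "finite I" and mul: "\<And>l x y. E l (mul x y) = E l x * E l y"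
    and nonzero: "\<And>l. \<exists>x. E l x \<noteq> 0" and distinct: "\<And>l l'. l \<noteq> l' \<Longrightarrow> \<exists>x. E l x \<noteq> E l' x"
    and zero: "\<And>x. (\<Sum>i\<in>I. c i * E (lab i) x) = 0"
  shows "(\<Sum>i\<in>I. smul (c i) (\<Theta> (lab i))) = 0"
proof -
  define g where "g l = (\<Sum>i\<in>{i \<in> I. lab i = l}. c i)" for l
  have "(\<Sum>l\<in>lab ` I. g l * E l x) = 0" for x
  proof -
    have "(\<Sum>i\<in>I. c i * E (lab i) x) = (\<Sum>l\<in>lab ` I. \<Sum>i\<in>{i \<in> I. lab i = l}. c i * E (lab i) x)"
      by (rule sum.image_gen[OF fin])
    also have "\<dots> = (\<Sum>l\<in>lab ` I. g l * E l x)"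
      by (simp add: g_def sum_distrib_right)
    finally show ?thesis using zero by simp
  qed
  then have g: "g l = 0" if "l \<in> lab ` I" for l
    using characters_independent[of "lab ` I" E mul g l] assms that by blast
  have "(\<Sum>i\<in>I. smul (c i) (\<Theta> (lab i)))
      = (\<Sum>l\<in>lab ` I. \<Sum>i\<in>{i \<in> I. lab i = l}. smul (c i) (\<Theta> (lab i)))"
    by (rule sum.image_gen[OF fin])
  also have "\<dots> = (\<Sum>l\<in>lab ` I. smul (g l) (\<Theta> l))"
    by (simp add: g_def smul_sum_left)
  also have "\<dots> = 0" using g by simp
  finally show ?thesis .
qed

definition monom_value :: "(nat \<Rightarrow> 'k::field) \<Rightarrow> nat multiset \<Rightarrow> 'k"
  where "monom_value a M = (\<Prod>x\<in>#M. a x)"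

lemma monom_value_simps [simp]:
  "monom_value a {#} = 1" "monom_value a (add_mset x M) = a x * monom_value a M"
  "monom_value (\<lambda>_. 1) M = 1"
  "monom_value (\<lambda>x. a x * b x) M = monom_value a M * monom_value b M"
  by (simp_all add: monom_value_def prod_mset.distrib)

lemma monom_value_mset: "monom_value a (mset w) = prod_list (map a w)"
  by (induction w) simp_all

text \<open>
  Substituting 2 for one variable and 1 for the others gives \<open>2\<^sup>n\<close>, where \<open>n\<close> is the
  multiplicity of that variable. In characteristic zero this determines \<open>n\<close>.
\<close>

lemma monom_value_distinct:
  assumes "M \<noteq> N"
  obtains a :: "nat \<Rightarrow> 'k::field_char_0" where "monom_value a M \<noteq> monom_value a N"
proof -
  from assms obtain j where j: "count M j \<noteq> count N j"
    by (metis multiset_eqI)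
  have "monom_value (\<lambda>x. if x = j then 2 else 1 :: 'k) M = of_nat (2 ^ count M j)" for M
    by (induction M) auto
  with j show ?thesis
    by (intro that[of "\<lambda>x. if x = j then 2 else 1"]) (simp only: of_nat_eq_iff, simp)
qed

definition mon :: "nat list \<Rightarrow> 'k::field free_alg"
  where "mon w = Poly_Mapping.single (Monomial w) 1"

lemma mon_append: "mon (v @ w) = mon v * mon w"
  by (simp add: mon_def mult_single plus_monomial_def)

lemma mon_Nil [simp]: "mon [] = 1"
  by (simp add: mon_def single_one flip: zero_monomial_def)

lemma mon_Cons: "mon (x # w) = mon [x] * mon w"
  using mon_append[of "[x]" w] by simp

lemma mon_single: "mon [x] = var x"
  by (simp add: mon_def var_def)

lemma mon_cong_mset: "mset v = mset w \<Longrightarrow> mon v - mon w \<in> (comm_ideal :: 'k::field free_alg set)"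
proof (induction v arbitrary: w)
  case Nil
  then show ?case by (simp add: comm_idealD)
next
  case (Cons x v)
  then have "x \<in> set w" by (metis list.set_intros(1) mset_eq_setD)
  then obtain p q where w: "w = p @ x # q" by (meson split_list)
  have "mset v = mset (p @ q)" using Cons.prems w by simp
  then have "mon v - mon (p @ q) \<in> (comm_ideal :: 'k free_alg set)" by (rule Cons.IH)
  then have "mon [x] * (mon v - mon (p @ q)) + commutator (mon [x]) (mon p) * mon q
      \<in> (comm_ideal :: 'k free_alg set)"
    by (rule comm_idealD(2)[OF comm_idealD(3) comm_idealD(4)[OF commutator_in_comm_ideal]])
  also have "mon [x] * (mon v - mon (p @ q)) + commutator (mon [x]) (mon p) * mon q
      = mon (x # v) - mon w"
    unfolding w mon_append mon_Cons[of x v] mon_Cons[of x q]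
    by (simp add: commutator_def algebra_simps)
  finally show ?case .
qed

definition sorted_mon :: "nat multiset \<Rightarrow> 'k::field free_alg"
  where "sorted_mon M = mon (sorted_list_of_multiset M)"

lemma mon_sorted: "mon w - sorted_mon (mset w) \<in> comm_ideal"
  unfolding sorted_mon_def by (rule mon_cong_mset) simp

text \<open>
  Splitting a word at a letter and forgetting the order on both sides leaves exactly the data on
  which the corresponding summand of the upper right entry depends (\<open>cross_base_mon\<close>).
\<close>

definition split_at :: "nat list \<Rightarrow> nat \<Rightarrow> nat multiset \<times> nat \<times> nat multiset"
  where "split_at w i = (mset (take i w), w ! i, mset (drop (Suc i) w))"

text \<open>
  The error of sorting one letter into a sorted word, after a sorted prefix. It depends only on the
  data of \<open>split_at\<close>.
\<close>

definition sort_defect :: "nat multiset \<times> nat \<times> nat multiset \<Rightarrow> 'k::field free_alg"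
  where "sort_defect = (\<lambda>(p, x, q).
    sorted_mon p * (mon [x] * sorted_mon q - sorted_mon (add_mset x q)))"

text \<open>
  The word is sorted from its end, one letter after the other; each step contributes one summand.
\<close>

lemma sort_telescope:
  "(mon w :: 'k::field free_alg) - sorted_mon (mset w) = (\<Sum>i<length w. mon (take i w) *
    (mon [w ! i] * sorted_mon (mset (drop (Suc i) w)) - sorted_mon (mset (drop i w))))"
proof (induction w)
  case Nil
  show ?case by (simp add: sorted_mon_def)
next
  case (Cons x w)
  have "(mon (x # w) :: 'k free_alg) - sorted_mon (mset (x # w)) = mon [x] * (mon w - sorted_mon (mset w))
      + (mon [x] * sorted_mon (mset w) - sorted_mon (mset (x # w)))"
    by (subst mon_Cons) (simp add: algebra_simps)
  also have "(mon [x] :: 'k free_alg) * (mon w - sorted_mon (mset w)) = (\<Sum>i<length w. mon (take (Suc i) (x # w)) *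
    (mon [w ! i] * sorted_mon (mset (drop (Suc i) w)) - sorted_mon (mset (drop i w))))"
    unfolding Cons.IH sum_distrib_left
    by (intro sum.cong refl) (simp add: mon_Cons[of x "take _ _"] mult.assoc)
  finally show ?case
    by (simp add: sum.lessThan_Suc_shift del: sum.lessThan_Suc)
qed

text \<open>
  In each summand of \<open>sort_telescope\<close> the second factor is in the commutator ideal, so sorting the
  prefix in front of it changes the summand only by a product of two elements of that ideal.
\<close>

lemma sort_expansion:
  assumes J: "add_subgroup J" and CC: "\<And>c d. c \<in> comm_ideal \<Longrightarrow> d \<in> comm_ideal \<Longrightarrow> c * d \<in> J"
  shows "free_scale k (mon w) - free_scale k (sorted_mon (mset w))
    - (\<Sum>i<length w. free_scale k (sort_defect (split_at w i))) \<in> J"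
proof -
  have "free_scale k (mon w - sorted_mon (mset w))
      - (\<Sum>i<length w. free_scale k (sort_defect (split_at w i)))
    = (\<Sum>i<length w. free_scale k (mon (take i w) - sorted_mon (mset (take i w))) *
        (mon [w ! i] * sorted_mon (mset (drop (Suc i) w)) - sorted_mon (mset (drop i w))))"
    unfolding sort_telescope[of w] free.smul_sum sum_subtractf[symmetric]
    by (intro sum.cong refl)
      (simp add: sort_defect_def split_at_def free_scale_eq_mult algebra_simps
        flip: Cons_nth_drop_Suc)
  also have "\<dots> \<in> J"
  proof (intro add_subgroup_sum[OF J] CC)
    fix i assume "i \<in> {..<length w}"
    then have i: "drop i w = w ! i # drop (Suc i) w"
      by (simp add: Cons_nth_drop_Suc)
    show "free_scale k (mon (take i w) - sorted_mon (mset (take i w))) \<in> comm_ideal"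
      unfolding free_scale_eq_mult by (intro comm_idealD mon_sorted)
    have "(mon (drop i w) - sorted_mon (mset (drop i w)))
        - mon [w ! i] * (mon (drop (Suc i) w) - sorted_mon (mset (drop (Suc i) w))) \<in> comm_ideal"
      by (intro comm_idealD mon_sorted)
    also have "(mon (drop i w) - sorted_mon (mset (drop i w)))
        - mon [w ! i] * (mon (drop (Suc i) w) - sorted_mon (mset (drop (Suc i) w)))
      = mon [w ! i] * sorted_mon (mset (drop (Suc i) w)) - sorted_mon (mset (drop i w))"
      unfolding i mon_Cons[of "w ! i" "drop (Suc i) w"] by (simp add: algebra_simps)
    finally show "mon [w ! i] * sorted_mon (mset (drop (Suc i) w)) - sorted_mon (mset (drop i w))
      \<in> comm_ideal" .
  qed
  finally show ?thesis
    by (simp add: free_scale_eq_mult algebra_simps)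
qed

lemma (in scalar_action) cross_const [simp]: "cross a m b (Poly_Mapping.single 0 c) = 0"
  using scalar_action.eval_const[OF scalar_action_upper2] by (simp add: cross_def)

lemma (in scalar_action) cross_var [simp]: "cross a m b (var i) = m i"
  using scalar_action.eval_var[OF scalar_action_upper2] by (simp add: cross_def)

lemma single_eq_mon: "Poly_Mapping.single w c = free_scale c (mon (letters w))"
  by (simp add: free_scale_eq_mult mon_def mult_single)

lemma eval_base_mon: "eval_poly (*) a (mon w) = monom_value (a :: nat \<Rightarrow> 'k::field) (mset w)"
  by (simp add: mon_def monom_value_mset)

lemma cross_base_mon:
  "base.cross a m b (mon w) = (\<Sum>i<length w.
    monom_value a (mset (take i w)) * (m (w ! i) * monom_value (b :: nat \<Rightarrow> 'k::field) (mset (drop (Suc i) w))))"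
proof (induction w)
  case Nil
  show ?case using base.cross_const[of a m b 1] by simp
next
  case (Cons x w)
  have "base.cross a m b (mon (x # w)) = a x * base.cross a m b (mon w) + m x * monom_value b (mset w)"
    by (subst mon_Cons) (simp add: base.cross_mult eval_base_mon mon_single)
  then show ?case
    unfolding Cons.IH
    by (simp add: sum.lessThan_Suc_shift sum_distrib_left mult.assoc del: sum.lessThan_Suc)
qed

lemma free_alg_expansion:
  "f = (\<Sum>w\<in>Poly_Mapping.keys f. free_scale (Poly_Mapping.lookup f w) (mon (letters w)))"
  for f :: "'k::field free_alg"
  unfolding single_eq_mon[symmetric]
  by (rule poly_mapping_eqI) (auto simp: lookup_sum lookup_single when_def in_keys_iff
      intro: sum.neutral)

text \<open>
  The group \<open>J\<close> stands for the additive span of the products \<open>c * d\<close>. By \<open>sort_expansion\<close> the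
  polynomial is, modulo \<open>J\<close>, a combination of sorted words and sorting defects. Its values at scalars
  show that the former cancel, and the upper right entries show the same for the latter, because
  \<open>split_at w i\<close> is recorded by the character \<open>a\<^sup>p m\<^sub>x b\<^sup>q\<close>.
\<close>

theorem identities_of_UT2_field:
  fixes f :: "'k::field_char_0 free_alg"
  assumes J: "add_subgroup J" and CC: "\<And>c d. c \<in> comm_ideal \<Longrightarrow> d \<in> comm_ideal \<Longrightarrow> c * d \<in> J"
    and eval: "\<And>a. eval_poly (*) a f = 0" and cross: "\<And>a m b. base.cross a m b f = 0"
  shows "f \<in> J"
proof -
  define W where "W = Poly_Mapping.keys f"
  define c where "c = Poly_Mapping.lookup f"
  have f: "f = (\<Sum>w\<in>W. free_scale (c w) (mon (letters w)))"
    unfolding W_def c_def by (rule free_alg_expansion)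
  have fin: "finite W" by (simp add: W_def)
  have 1: "(\<Sum>w\<in>W. free_scale (c w) (sorted_mon (mset (letters w)))) = 0"
  proof (rule free.characters_separate[where E = "\<lambda>M a. monom_value a M"
        and mul = "\<lambda>a b x. a x * b x" and lab = "\<lambda>w. mset (letters w)", OF fin])
    show "\<exists>a. monom_value a M \<noteq> (0 :: 'k)" for M
      by (rule exI[of _ "\<lambda>_. 1"]) simp
    show "\<exists>a. monom_value a M \<noteq> (monom_value a N :: 'k)" if "M \<noteq> N" for M N
      using monom_value_distinct[OF that] by blast
    show "(\<Sum>w\<in>W. c w * monom_value a (mset (letters w))) = 0" for a
      using eval[of a] unfolding f by (simp add: free_scale_eq_mult eval_base_mon)
  qed simp
  let ?I = "Sigma W (\<lambda>w. {..<length (letters w)})"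
  let ?E = "\<lambda>(p, x, q) (a, m, b). monom_value a p * (m x * (monom_value b q :: 'k))"
  have "(\<Sum>j\<in>?I. free_scale (c (fst j)) (sort_defect (split_at (letters (fst j)) (snd j)))) = 0"
  proof (rule free.characters_separate[where E = ?E and lab = "\<lambda>j. split_at (letters (fst j)) (snd j)"
        and mul = "\<lambda>(a, m, b) (a', m', b'). (\<lambda>x. a x * a' x, \<lambda>x. m x * m' x, \<lambda>x. b x * b' x)"])
    show "finite ?I" using fin by simp
    show "?E l ((\<lambda>(a, m, b) (a', m', b'). (\<lambda>x. a x * a' x, \<lambda>x. m x * m' x, \<lambda>x. b x * b' x)) x y)
        = ?E l x * ?E l y" for l x y
      by (cases l; cases x; cases y) (simp add: mult_ac)
    show "\<exists>x. ?E l x \<noteq> 0" for l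
      by (rule exI[of _ "(\<lambda>_. 1, \<lambda>_. 1, \<lambda>_. 1)"]) (simp add: case_prod_unfold)
    show "\<exists>y. ?E l y \<noteq> ?E l' y" if "l \<noteq> l'" for l l'
    proof -
      obtain p x q p' x' q' where l: "l = (p, x, q)" "l' = (p', x', q')"
        by (cases l; cases l')
      with that consider "p \<noteq> p'" | "x \<noteq> x'" | "q \<noteq> q'" by blast
      then show ?thesis
      proof cases
        case 1
        from monom_value_distinct[OF this] obtain a where "monom_value a p \<noteq> (monom_value a p' :: 'k)" .
        then show ?thesis unfolding l by (intro exI[of _ "(a, \<lambda>_. 1, \<lambda>_. 1)"]) simp
      next
        case 2
        then show ?thesis
          unfolding l by (intro exI[of _ "(\<lambda>_. 1, \<lambda>y. if y = x then 0 else 1, \<lambda>_. 1)"]) simp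
      next
        case 3
        from monom_value_distinct[OF this] obtain b where "monom_value b q \<noteq> (monom_value b q' :: 'k)" .
        then show ?thesis unfolding l by (intro exI[of _ "(\<lambda>_. 1, \<lambda>_. 1, b)"]) simp
      qed
    qed
    show "(\<Sum>j\<in>?I. c (fst j) * ?E (split_at (letters (fst j)) (snd j)) x) = 0" for x
    proof (cases x)
      case (fields a m b)
      have "(\<Sum>w\<in>W. c w * base.cross a m b (mon (letters w))) = 0"
        using cross[of a m b] unfolding f by (simp add: free_scale_eq_mult base.cross_sum base.cross_mult)
      also have "(\<Sum>w\<in>W. c w * base.cross a m b (mon (letters w)))
        = (\<Sum>w\<in>W. \<Sum>i<length (letters w). c w * ?E (split_at (letters w) i) (a, m, b))"
        by (simp add: cross_base_mon sum_distrib_left split_at_def)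
      finally show ?thesis
        using fin by (simp add: fields sum.Sigma case_prod_unfold)
    qed
  qed
  then have 2: "(\<Sum>w\<in>W. \<Sum>i<length (letters w).
      free_scale (c w) (sort_defect (split_at (letters w) i))) = 0"
    using fin by (simp add: sum.Sigma case_prod_unfold)
  have "(\<Sum>w\<in>W. free_scale (c w) (mon (letters w)) - free_scale (c w) (sorted_mon (mset (letters w)))
      - (\<Sum>i<length (letters w). free_scale (c w) (sort_defect (split_at (letters w) i)))) \<in> J"
    by (intro add_subgroup_sum[OF J] sort_expansion J CC)
  then show ?thesis
    unfolding sum_subtractf 1 2 f[symmetric] by simp
qed

section \<open>Grading of the Grassmann algebra\<close>

definition gkeys :: "'k::zero grassmann \<Rightarrow> nat fset set"
  where "gkeys x = Poly_Mapping.keys (gcoeffs x)"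

text \<open>
  The elements of degree at least \<open>d\<close> in the generators with index in \<open>S\<close>. For \<open>d = 0\<close> this is the
  Grassmann algebra on \<open>S\<close>; for finite \<open>S\<close> only zero is left once \<open>d\<close> exceeds \<open>card S\<close>.
\<close>

definition graded :: "nat set \<Rightarrow> nat \<Rightarrow> 'k::zero grassmann set"
  where "graded S d = {x. \<forall>K\<in>gkeys x. fset K \<subseteq> S \<and> d \<le> fcard K}"

lemma gkeys_zero [simp]: "gkeys 0 = {}"
  by (simp add: gkeys_def zero_grassmann.rep_eq)

lemma gkeys_empty_iff: "gkeys x = {} \<longleftrightarrow> x = 0"
  by (simp add: gkeys_def zero_grassmann.rep_eq flip: gcoeffs_inject)

lemma gkeys_add: "gkeys (x + y) \<subseteq> gkeys x \<union> gkeys (y :: 'k::ring_1 grassmann)"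
  unfolding gkeys_def plus_grassmann.rep_eq by (rule Poly_Mapping.keys_add)

lemma gkeys_uminus [simp]: "gkeys (- x) = gkeys (x :: 'k::ring_1 grassmann)"
  by (simp add: gkeys_def uminus_grassmann.rep_eq)

lemma keys_sum_single_subset:
  "Poly_Mapping.keys (\<Sum>S\<in>A. \<Sum>T\<in>B. Poly_Mapping.single (u S T) (h S T :: 'b::comm_monoid_add))
    \<subseteq> {u S T |S T. S \<in> A \<and> T \<in> B \<and> h S T \<noteq> 0}"
proof -
  have "Poly_Mapping.keys (\<Sum>S\<in>A. \<Sum>T\<in>B. Poly_Mapping.single (u S T) (h S T))
      \<subseteq> (\<Union>S\<in>A. \<Union>T\<in>B. Poly_Mapping.keys (Poly_Mapping.single (u S T) (h S T)))"
    by (intro order_trans[OF Poly_Mapping.keys_sum] UN_mono order_refl Poly_Mapping.keys_sum)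
  also have "\<dots> \<subseteq> {u S T |S T. S \<in> A \<and> T \<in> B \<and> h S T \<noteq> 0}"
    by (auto split: if_splits)
  finally show ?thesis .
qed

lemma gkeys_mult:
  "gkeys (x * y) \<subseteq> {S |\<union>| T |S T. S \<in> gkeys x \<and> T \<in> gkeys y \<and> S |\<inter>| T = {||}}"
  for x y :: "'k::ring_1 grassmann"
proof -
  have "gsign S T * c \<noteq> 0 \<Longrightarrow> S |\<inter>| T = {||}" for S T and c :: 'k
    by (auto simp: gsign_def split: if_splits)
  then show ?thesis
    unfolding gkeys_def times_grassmann.rep_eq gmult_def
    by (intro order_trans[OF keys_sum_single_subset]) blast
qed

text \<open>
  If \<open>S\<close> and \<open>T\<close> are disjoint, each pair in \<open>S \<times> T\<close> is an inversion for exactly one of the two orders of juxtaposition.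
\<close>

lemma gsign_swap:
  "gsign T S = (- 1) ^ (fcard S * fcard T) * (gsign S T :: 'k::field)"
proof (cases "S |\<inter>| T = {||}")
  case True
  let ?A = "{(s, t). s |\<in>| S \<and> t |\<in>| T \<and> t < s}" and ?B = "{(t, s). t |\<in>| T \<and> s |\<in>| S \<and> s < t}"
  have fin: "finite ?A" "finite ?B"
    by (rule finite_subset[of _ "fset S \<times> fset T"]; auto)
      (rule finite_subset[of _ "fset T \<times> fset S"]; auto)
  have "fset S \<times> fset T = ?A \<union> prod.swap ` ?B" (is "_ = _ \<union> ?B'")
  proof (intro equalityI subsetI)
    fix z assume "z \<in> fset S \<times> fset T"
    then obtain s t where z: "z = (s, t)" "s |\<in>| S" "t |\<in>| T" by auto
    with True have "s \<noteq> t" by auto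
    then consider "t < s" | "s < t" by linarith
    then show "z \<in> ?A \<union> ?B'"
    proof cases
      case 2
      then have "(t, s) \<in> ?B" using z by simp
      then have "prod.swap (t, s) \<in> ?B'" by (rule imageI)
      then show ?thesis using z by simp
    qed (use z in simp)
  qed auto
  moreover have "?A \<inter> ?B' = {}" by auto
  moreover have "card ?B' = card ?B" by (rule card_image) (simp add: inj_on_def)
  moreover have "fcard S * fcard T = card (fset S \<times> fset T)"
    by (simp only: card_cartesian_product fcard.rep_eq)
  ultimately have "fcard S * fcard T = card ?A + card ?B"
    using card_Un_disjoint[OF fin(1) finite_imageI[OF fin(2), of prod.swap]] by argo
  then have "(- 1) ^ (fcard S * fcard T) * (- 1) ^ card ?A = (- 1 :: 'k) ^ (card ?A + card ?A + card ?B)"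
    by (simp add: power_add mult_ac)
  also have "\<dots> = (- 1) ^ card ?B"
    by (simp add: power_add flip: mult_2)
  finally show ?thesis using True by (simp add: gsign_def inf_commute)
next
  case False
  then show ?thesis by (simp add: gsign_def inf_commute)
qed

text \<open>
  By \<open>gsign_swap\<close> two basis elements commute unless both have odd degree. Hence commutators have
  even degree, which makes them central, and degree at least 2.
\<close>

lemma gkeys_commutator:
  "gkeys (commutator x y) \<subseteq> {S |\<union>| T |S T. S \<in> gkeys x \<and> T \<in> gkeys y \<and> S |\<inter>| T = {||}
    \<and> odd (fcard S) \<and> odd (fcard T)}"
  for x y :: "'k::field grassmann"
proof -
  let ?f = "gcoeffs x" and ?g = "gcoeffs y"
  let ?h = "\<lambda>S T. (gsign S T - gsign T S) * (Poly_Mapping.lookup ?f S * Poly_Mapping.lookup ?g T)"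
  have "gmult ?g ?f = (\<Sum>S\<in>Poly_Mapping.keys ?f. \<Sum>T\<in>Poly_Mapping.keys ?g.
      Poly_Mapping.single (S |\<union>| T) (gsign T S * (Poly_Mapping.lookup ?f S * Poly_Mapping.lookup ?g T)))"
    unfolding gmult_def by (subst sum.swap) (simp add: sup_commute mult.commute)
  then have eq: "gcoeffs (commutator x y) = (\<Sum>S\<in>Poly_Mapping.keys ?f. \<Sum>T\<in>Poly_Mapping.keys ?g.
      Poly_Mapping.single (S |\<union>| T) (?h S T))"
    unfolding commutator_def minus_grassmann.rep_eq times_grassmann.rep_eq
    by (simp add: gmult_def single_diff left_diff_distrib sum_subtractf)
  have sub: "gkeys (commutator x y) \<subseteq> {S |\<union>| T |S T. S \<in> gkeys x \<and> T \<in> gkeys y \<and> ?h S T \<noteq> 0}"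
    unfolding gkeys_def eq by (rule keys_sum_single_subset)
  have odd: "S |\<inter>| T = {||} \<and> odd (fcard S) \<and> odd (fcard T)" if "?h S T \<noteq> 0" for S T
  proof -
    have ne: "gsign S T \<noteq> (gsign T S :: 'k)" using that by auto
    then have "odd (fcard S * fcard T)"
      using gsign_swap[of T S, where 'k = 'k] by auto
    moreover have "S |\<inter>| T = {||}"
      using ne by (auto simp: gsign_def inf_commute split: if_splits)
    ultimately show ?thesis by simp
  qed
  show ?thesis
  proof
    fix K assume "K \<in> gkeys (commutator x y)"
    from subsetD[OF sub this] obtain S T
      where ST: "K = S |\<union>| T" "S \<in> gkeys x" "T \<in> gkeys y" "?h S T \<noteq> 0"
      by (elim CollectE exE conjE)
    show "K \<in> {S |\<union>| T |S T. S \<in> gkeys x \<and> T \<in> gkeys y \<and> S |\<inter>| T = {||}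
        \<and> odd (fcard S) \<and> odd (fcard T)}"
      using ST(1-3) odd[OF ST(4)] by (intro CollectI exI[of _ S] exI[of _ T]) simp
  qed
qed

lemma gkeys_commutator_even:
  fixes x y :: "'k::field grassmann"
  assumes "K \<in> gkeys (commutator x y)"
  shows "even (fcard K)"
proof -
  obtain S T where "K = S |\<union>| T" "S |\<inter>| T = {||}" "odd (fcard S)" "odd (fcard T)"
    using subsetD[OF gkeys_commutator assms] by blast
  then show ?thesis by (simp add: fcard_funion_disjoint)
qed

lemma even_central:
  fixes x y :: "'k::field grassmann"
  assumes "\<And>K. K \<in> gkeys x \<Longrightarrow> even (fcard K)"
  shows "commutator x y = 0"
  using assms gkeys_commutator[of x y] by (auto simp flip: gkeys_empty_iff)

lemma triple_commutator_grassmann: "commutator (commutator x y) z = (0 :: 'k::field grassmann)"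
  by (rule even_central) (rule gkeys_commutator_even)

lemma commutator_central: "commutator x y * z = z * (commutator x y :: 'k::field grassmann)"
  using triple_commutator_grassmann[of x y z] by (simp add: commutator_def)

lemma graded_zero [simp]: "0 \<in> graded S d"
  by (simp add: graded_def)

lemma graded_add: "x \<in> graded S d \<Longrightarrow> y \<in> graded S d \<Longrightarrow> x + y \<in> graded S (d::nat)"
  for x y :: "'k::ring_1 grassmann"
  using gkeys_add[of x y] by (auto simp: graded_def)

lemma graded_mult:
  fixes x y :: "'k::ring_1 grassmann"
  assumes "x \<in> graded S d" "y \<in> graded S e"
  shows "x * y \<in> graded S (d + e)"
  unfolding graded_def
proof (intro CollectI ballI)
  fix K assume *: "K \<in> gkeys (x * y)"
  then obtain A B where K: "K = A |\<union>| B" "A \<in> gkeys x" "B \<in> gkeys y" "A |\<inter>| B = {||}"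
    using subsetD[OF gkeys_mult *] by blast
  then show "fset K \<subseteq> S \<and> d + e \<le> fcard K"
    using assms by (auto simp: graded_def fcard_funion_disjoint intro!: add_mono)
qed

lemma graded_mono: "e \<le> d \<Longrightarrow> S \<subseteq> S' \<Longrightarrow> graded S d \<subseteq> graded S' e"
  by (fastforce simp: graded_def)

lemma graded_commutator:
  fixes x y :: "'k::field grassmann"
  assumes "x \<in> graded S d" "y \<in> graded S e"
  shows "commutator x y \<in> graded S 2"
  unfolding graded_def
proof (intro CollectI ballI)
  fix K assume *: "K \<in> gkeys (commutator x y)"
  then obtain A B where K: "K = A |\<union>| B" "A \<in> gkeys x" "B \<in> gkeys y" "A |\<inter>| B = {||}"
    "odd (fcard A)" "odd (fcard B)"
    using subsetD[OF gkeys_commutator *] by blast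
  then have "1 \<le> fcard A" "1 \<le> fcard B" by (auto simp: Suc_le_eq intro!: Nat.gr0I)
  then have "2 \<le> fcard A + fcard B" by simp
  with K show "fset K \<subseteq> S \<and> 2 \<le> fcard K"
    using assms by (auto simp: graded_def fcard_funion_disjoint)
qed

lemma graded_eq_0:
  assumes "x \<in> graded S d" "finite S" "card S < d"
  shows "x = (0 :: 'k::ring_1 grassmann)"
proof -
  have "gkeys x = {}"
  proof (rule ccontr)
    assume "gkeys x \<noteq> {}"
    then obtain K where "fset K \<subseteq> S" "d \<le> card (fset K)"
      using assms(1) by (auto simp: graded_def fcard.rep_eq)
    with assms(2,3) card_mono[of S "fset K"] show False by simp
  qed
  then show ?thesis by (simp add: gkeys_empty_iff)
qed

lemma graded_scalar [simp]: "grassmann_scale c 1 \<in> graded S 0"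
  for c :: "'k::field"
proof -
  have "gcoeffs (grassmann_scale c 1) = Poly_Mapping.single {||} c"
    by (simp add: grassmann_scale_eq_mult gconst.rep_eq)
  then show ?thesis by (simp add: graded_def gkeys_def)
qed

lemma grassmann_alg_eq_graded: "grassmann_alg k = graded {..<k} 0"
  by (simp add: grassmann_alg_def graded_def gkeys_def)

lemma graded_ggen: "i \<in> S \<Longrightarrow> (ggen i :: 'k::ring_1 grassmann) \<in> graded S 1"
  by (simp add: graded_def gkeys_def ggen.rep_eq fcard.rep_eq)

lemma eval_graded:
  fixes f :: "'k::field free_alg"
  assumes "\<And>i. a i \<in> graded S 0"
  shows "eval_poly grassmann_scale a f \<in> graded S 0"
  using assms graded_mult[of _ S 0 _ 0]
  by (intro gr.eval_in_subalgebra) (auto intro: graded_add)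

lemma eval_comm_ideal_graded:
  fixes c :: "'k::field free_alg"
  assumes "\<And>i. a i \<in> graded S 0" "c \<in> comm_ideal"
  shows "eval_poly grassmann_scale a c \<in> graded S 2"
proof -
  let ?I = "{c. eval_poly grassmann_scale a c \<in> graded S 2}"
  have ev: "eval_poly grassmann_scale a f \<in> graded S 0" for f
    by (rule eval_graded) (rule assms)
  have "eval_poly grassmann_scale a (g * f) \<in> graded S 2"
    "eval_poly grassmann_scale a (f * g) \<in> graded S 2" if "f \<in> ?I" for f g
    using graded_mult[OF ev[of g], of "eval_poly grassmann_scale a f" 2]
      graded_mult[OF _ ev[of g], of "eval_poly grassmann_scale a f" 2] that
    by (simp_all add: numeral_2_eq_2)
  then have "two_sided_ideal ?I"
    by (auto simp: two_sided_ideal_def simp del: gr.eval_mult intro: graded_add)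
  then have "comm_ideal \<subseteq> ?I"
    by (rule comm_ideal_minimal) (auto intro: graded_commutator ev)
  with assms(2) show ?thesis by blast
qed

lemma eval_triple_ideal:
  fixes t :: "'k::field free_alg"
  assumes "t \<in> triple_ideal"
  shows "eval_poly grassmann_scale a t = 0"
proof -
  have "triple_ideal \<subseteq> {t. eval_poly grassmann_scale a t = 0}"
    by (rule triple_ideal_minimal) (auto simp: two_sided_ideal_def triple_commutator_grassmann)
  with assms show ?thesis by blast
qed

section \<open>The generators are identities\<close>

lemma UT2_iff: "0 \<in> R \<Longrightarrow> M \<in> UT2 R \<longleftrightarrow> ul M \<in> R \<and> ur M \<in> R \<and> lr M \<in> R"
  by (auto simp: UT2_def forall_2 ul_def ur_def lr_def upper2_lower_left)

lemma graded_0_mult: "x \<in> graded S 0 \<Longrightarrow> y \<in> graded S 0 \<Longrightarrow> x * y \<in> graded S 0"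
  for x y :: "'k::ring_1 grassmann"
  using graded_mult[of x S 0 y 0] by simp

lemma T_ideal_identities_UT2:
  "T_ideal (polynomial_identities (upper2_scale grassmann_scale)
    (UT2 (graded S 0 :: 'k::field grassmann set)))"
  by (rule scalar_action.T_ideal_polynomial_identities[OF gr.scalar_action_upper2])
    (auto simp: UT2_iff intro: graded_add graded_0_mult)

lemma upper2_commutator [simp]:
  "ul (commutator M N) = commutator (ul M) (ul N)" "lr (commutator M N) = commutator (lr M) (lr N)"
  for M N :: "'a::ring_1 upper2"
  by (simp_all add: commutator_def)

lemma triple_generator_identity:
  "commutator (commutator (var 0) (var 1)) (var 2) *
    commutator (commutator (var 3) (var 4)) (var 5)
    \<in> polynomial_identities (upper2_scale grassmann_scale) (UT2 (R :: 'k::field grassmann set))"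
proof -
  interpret up: scalar_action "upper2_scale (grassmann_scale :: 'k \<Rightarrow> _)"
    by (rule gr.scalar_action_upper2)
  show ?thesis
    by (simp add: polynomial_identities_def upper2_eq_iff triple_commutator_grassmann)
qed

text \<open>
  In the corner of a product one factor contributes its corner entry and all others contribute
  diagonal entries, so only one factor fails to add 2 to the degree.
\<close>

lemma graded_upper2_product:
  fixes Ms :: "'k::field grassmann upper2 list"
  assumes "\<And>M. M \<in> set Ms \<Longrightarrow> ul M \<in> graded S 2 \<and> ur M \<in> graded S 0 \<and> lr M \<in> graded S 2"
  shows "ul (prod_list Ms) \<in> graded S (2 * length Ms) \<and>
    ur (prod_list Ms) \<in> graded S (2 * length Ms - 2) \<and> lr (prod_list Ms) \<in> graded S (2 * length Ms)"
  using assms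
proof (induction Ms)
  case Nil
  show ?case using graded_scalar[of "1 :: 'k" S] by (simp add: gr.smul_one)
next
  case (Cons M Ms)
  let ?P = "prod_list Ms"
  have M: "ul M \<in> graded S 2" "ur M \<in> graded S 0" "lr M \<in> graded S 2"
    using Cons.prems by simp_all
  have P: "ul ?P \<in> graded S (2 * length Ms)" "ur ?P \<in> graded S (2 * length Ms - 2)"
    "lr ?P \<in> graded S (2 * length Ms)"
    using Cons by simp_all
  have "ul M * ur ?P \<in> graded S (2 * length Ms)"
    by (rule subsetD[OF graded_mono graded_mult[OF M(1) P(2)]]) auto
  then show ?case
    using graded_mult[OF M(1) P(1)] graded_mult[OF M(3) P(3)] graded_mult[OF M(2) P(3)]
    by (simp add: graded_add)
qed

lemma commutator_generator_identity:
  assumes "finite S" "card S < 2 * n - 2"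
  shows "(\<Prod>i\<leftarrow>[0..<n]. commutator (var (2 * i)) (var (2 * i + 1)))
    \<in> polynomial_identities (upper2_scale grassmann_scale) (UT2 (graded S 0 :: 'k::field grassmann set))"
proof -
  interpret up: scalar_action "upper2_scale (grassmann_scale :: 'k \<Rightarrow> _)"
    by (rule gr.scalar_action_upper2)
  have "(\<Prod>i\<leftarrow>[0..<n]. commutator (M (2 * i)) (M (2 * i + 1))) = 0"
    if M: "\<forall>i. M i \<in> UT2 (graded S 0 :: 'k grassmann set)" for M
  proof -
    let ?Ms = "map (\<lambda>i. commutator (M (2 * i)) (M (2 * i + 1))) [0..<n]"
    have ent: "ul (M i) \<in> graded S 0 \<and> ur (M i) \<in> graded S 0 \<and> lr (M i) \<in> graded S 0" for i
      using M by (simp add: UT2_iff)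
    have minus: "x - y \<in> graded S 0" if "x \<in> graded S 0" "y \<in> graded S 0" for x y :: "'k grassmann"
      using graded_add[of x S 0 "- y"] that by (simp add: graded_def)
    have "ur (commutator (M i) (M j)) \<in> graded S 0" for i j
      using ent by (auto simp: commutator_def intro!: minus graded_add graded_0_mult)
    then have "ul N \<in> graded S 2 \<and> ur N \<in> graded S 0 \<and> lr N \<in> graded S 2" if "N \<in> set ?Ms" for N
      using that ent by (auto intro!: graded_commutator[where d = 0 and e = 0])
    then have P: "ul (prod_list ?Ms) \<in> graded S (2 * n)" "ur (prod_list ?Ms) \<in> graded S (2 * n - 2)"
        "lr (prod_list ?Ms) \<in> graded S (2 * n)"
      using graded_upper2_product[of ?Ms S] by simp_all
    show ?thesis
      unfolding upper2_eq_iff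
      using graded_eq_0[OF P(1)] graded_eq_0[OF P(2)] graded_eq_0[OF P(3)] assms by simp
  qed
  then show ?thesis
    by (simp add: polynomial_identities_def up.eval_prod_list comp_def)
qed

section \<open>Evaluation near the scalars\<close>

abbreviation gscalar :: "'k::field \<Rightarrow> 'k grassmann"
  where "gscalar c \<equiv> grassmann_scale c 1"

text \<open>
  If \<open>z\<close> is killed by the nilpotent parts of all substituted elements, then multiplying by \<open>z\<close>
  replaces every value by the value at the scalar parts. This turns statements over the Grassmann
  algebra into statements over the field.
\<close>

lemma eval_times_eigenvector:
  fixes f :: "'k::field free_alg"
  assumes "\<And>i. a i * z = grassmann_scale (\<alpha> i) z"
  shows "eval_poly grassmann_scale a f * z = grassmann_scale (eval_poly (*) \<alpha> f) z"
  by (induction f rule: free_alg_induct)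
    (simp_all add: assms gr.smul_mult_left gr.smul_mult_right gr.smul_add_left gr.smul_smul
      distrib_right mult.assoc mult.commute)

lemma cross_times_eigenvector:
  fixes f :: "'k::field free_alg"
  assumes a: "\<And>i. a i * z = grassmann_scale (\<alpha> i) z"
    and m: "\<And>i. m i * z = grassmann_scale (\<mu> i) z" and b: "\<And>i. b i * z = grassmann_scale (\<beta> i) z"
  shows "gr.cross a m b f * z = grassmann_scale (base.cross \<alpha> \<mu> \<beta> f) z"
proof (induction f rule: free_alg_induct)
  case (mult f g)
  have "gr.cross a m b (f * g) * z = eval_poly grassmann_scale a f * (gr.cross a m b g * z)
      + gr.cross a m b f * (eval_poly grassmann_scale b g * z)"
    by (simp add: gr.cross_mult distrib_right mult.assoc)
  also have "\<dots> = grassmann_scale (base.cross \<alpha> \<mu> \<beta> (f * g)) z"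
    unfolding mult.IH eval_times_eigenvector[of b z \<beta>, OF b] gr.smul_mult_right
      eval_times_eigenvector[of a z \<alpha>, OF a]
    by (simp add: gr.smul_smul gr.smul_add_left base.cross_mult mult.commute)
  finally show ?case .
qed (simp_all add: m gr.smul_add_left distrib_right)

lemma scale_faithful:
  assumes "gcoeffs z = Poly_Mapping.single K d" "d \<noteq> 0" "grassmann_scale c z = 0"
  shows "c = (0 :: 'k::field)"
proof -
  have "Poly_Mapping.single K (c * d) = 0"
    using arg_cong[OF assms(3), of gcoeffs]
    by (simp add: grassmann_scale.rep_eq assms(1) map_mult_single zero_grassmann.rep_eq)
  then have "Poly_Mapping.lookup (Poly_Mapping.single K (c * d)) K = 0"
    by (simp only: lookup_zero)
  with assms(2) show ?thesis by simp
qed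

lemma base_values_of_identity:
  fixes f :: "'k::field free_alg"
  assumes "f \<in> polynomial_identities (upper2_scale grassmann_scale) (UT2 (graded S 0))"
  shows "eval_poly (*) \<alpha> f = 0" "base.cross \<alpha> \<mu> \<beta> f = 0"
proof -
  let ?a = "\<lambda>i. gscalar (\<alpha> i)" and ?m = "\<lambda>i. gscalar (\<mu> i)" and ?b = "\<lambda>i. gscalar (\<beta> i)"
  have faithful: "c = 0" if "gscalar c = 0" for c :: 'k
    by (rule scale_faithful[of 1 "{||}" 1]) (simp_all add: one_grassmann.rep_eq that)
  have "gr.cross ?a ?m ?b f = 0" "eval_poly grassmann_scale ?a f = 0"
    using identity_entries[OF _ _ _ _ assms, of ?a ?m ?b] by simp_all
  then show "eval_poly (*) \<alpha> f = 0" "base.cross \<alpha> \<mu> \<beta> f = 0"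
    using eval_times_eigenvector[of ?a 1 \<alpha> f] cross_times_eigenvector[of ?a 1 \<alpha> ?m \<mu> ?b \<beta> f]
    by (simp_all add: faithful)
qed

lemma eval_base_comm_ideal:
  fixes c :: "'k::field free_alg"
  assumes "c \<in> comm_ideal"
  shows "eval_poly (*) \<alpha> c = 0"
proof -
  have "comm_ideal \<subseteq> {c. eval_poly (*) \<alpha> c = (0 :: 'k)}"
    by (rule comm_ideal_minimal) (auto simp: two_sided_ideal_def commutator_def)
  with assms show ?thesis by blast
qed

lemma gcoeffs_mult_single:
  fixes x y :: "'k::ring_1 grassmann"
  assumes "gcoeffs x = Poly_Mapping.single S c" "gcoeffs y = Poly_Mapping.single T d"
    and "\<And>s t. s |\<in>| S \<Longrightarrow> t |\<in>| T \<Longrightarrow> s < t"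
  shows "gcoeffs (x * y) = Poly_Mapping.single (S |\<union>| T) (c * d)"
proof -
  have "S |\<inter>| T = {||}" "{(s, t). s |\<in>| S \<and> t |\<in>| T \<and> t < s} = {}"
    using assms(3) by fastforce+
  then have "gsign S T = (1 :: 'k)"
    unfolding gsign_def by (simp only: if_True card.empty power_0 refl)
  then show ?thesis
    by (simp add: times_grassmann.rep_eq assms(1,2) gmult_single)
qed

text \<open>
  The element \<open>2 e\<^sub>n e\<^sub>n\<^sub>+\<^sub>1\<close>, written as a commutator to have centrality for free.
\<close>

definition area :: "nat \<Rightarrow> 'k::field grassmann"
  where "area n = commutator (ggen n) (ggen (Suc n))"

lemma area_central: "area n * x = x * area n"
  unfolding area_def by (rule commutator_central)

lemma area_eq: "area n = ggen n * ggen (Suc n) + ggen n * (ggen (Suc n) :: 'k::field grassmann)"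
  using ggen_anticommute[of "Suc n" n, where 'k = 'k] by (simp add: area_def commutator_def)

lemma gcoeffs_area: "gcoeffs (area n :: 'k::field grassmann) = Poly_Mapping.single {|n, Suc n|} 2"
proof -
  have "gcoeffs (ggen n * ggen (Suc n) :: 'k grassmann) = Poly_Mapping.single ({|n|} |\<union>| {|Suc n|}) (1 * 1)"
    by (rule gcoeffs_mult_single) (auto simp: ggen.rep_eq)
  then show ?thesis
    unfolding area_eq plus_grassmann.rep_eq by (simp add: finsert_commute flip: single_add)
qed

lemma area_graded: "{n, Suc n} \<subseteq> S \<Longrightarrow> (area n :: 'k::field grassmann) \<in> graded S 2"
  unfolding area_def by (rule graded_commutator) (rule graded_ggen; simp)+

text \<open>
  Adding this to scalars places the generators \<open>e\<^sub>n\<close> and \<open>e\<^sub>n\<^sub>+\<^sub>1\<close> at the two variables of \<open>p\<close>, so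
  that \<open>com p\<close> becomes the only nonzero commutator of two variables in increasing order.
\<close>

definition nilpart :: "nat \<Rightarrow> nat \<times> nat \<Rightarrow> nat \<Rightarrow> 'k::field grassmann"
  where "nilpart n p k = (if k = fst p then ggen n else if k = snd p then ggen (Suc n) else 0)"


lemma nilpart_graded: "{n, Suc n} \<subseteq> S \<Longrightarrow> nilpart n p k \<in> graded S 1"
  unfolding nilpart_def by (auto intro!: graded_ggen simp del: One_nat_def)

lemma nilpart_commutator:
  assumes "p \<in> pairs" "q \<in> pairs"
  shows "commutator (nilpart n p (fst q)) (nilpart n p (snd q))
    = (if q = p then area n else (0 :: 'k::field grassmann))"
proof -
  have "ggen n * ggen n = (0 :: 'k grassmann)" for n by (rule ggen_square)
  then show ?thesis
    using assms by (cases p; cases q) (auto simp: nilpart_def pairs_def commutator_def area_def)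
qed

lemma eval_com:
  "eval_poly grassmann_scale (\<lambda>k. gscalar (\<beta> k) + \<nu> k) (com q)
    = commutator (\<nu> (fst q)) (\<nu> (snd q) :: 'k::field grassmann)"
  by (simp add: com_def commutator_def algebra_simps gr.smul_mult_left gr.smul_mult_right
      gr.smul_add_right gr.smul_smul)

lemma eval_com_nilpart:
  assumes "p \<in> pairs" "q \<in> pairs"
  shows "eval_poly grassmann_scale (\<lambda>k. gscalar (\<beta> k) + nilpart n p k) (com q)
    = (if q = p then area n else (0 :: 'k::field grassmann))"
  unfolding eval_com by (rule nilpart_commutator[OF assms])

lemma com_in_comm_ideal: "com p \<in> comm_ideal"
  unfolding com_def by (rule commutator_in_comm_ideal)

lemma eval_scalars_comm_ideal:
  fixes c :: "'k::field free_alg"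
  assumes "c \<in> comm_ideal"
  shows "eval_poly grassmann_scale (\<lambda>k. gscalar (\<beta> k)) c = 0"
  by (rule graded_eq_0[OF eval_comm_ideal_graded[of _ "{}"]]) (use assms in simp_all)

lemma eigenvector:
  assumes "finite S" "x \<in> graded S 1" "z \<in> graded S (card S)"
  shows "(gscalar c + x) * z = grassmann_scale c (z :: 'k::field grassmann)"
proof -
  have "x * z = 0"
    by (rule graded_eq_0[OF graded_mult[OF assms(2,3)] assms(1)]) simp
  then show ?thesis by (simp add: distrib_right gr.smul_mult_left)
qed

lemma sum_isolated:
  assumes "finite A" "p \<in> A" "\<And>i. i \<in> A \<Longrightarrow> i \<noteq> p \<Longrightarrow> g i = (0 :: 'a::comm_monoid_add)"
  shows "sum g A = g p"
proof -
  have "sum g A = sum g {p}"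
    using assms by (intro sum.mono_neutral_right) auto
  then show ?thesis by simp
qed

section \<open>Two nilpotent generators\<close>

text \<open>
  The form in which the result over the field is applied to a single coefficient: \<open>F\<close> multiplies the
  coefficient by the commutators around it, and \<open>J\<close> absorbs the product once the coefficient is a
  sum of products of two elements of the commutator ideal.
\<close>

lemma identity_criterion:
  fixes c :: "'k::field_char_0 free_alg"
  assumes "add_subgroup J" "\<And>c d. c \<in> comm_ideal \<Longrightarrow> d \<in> comm_ideal \<Longrightarrow> F (c * d) \<in> J"
    and "\<And>x y. F (x - y) = F x - F y"
    and "c \<in> comm_ideal" "\<And>\<alpha> \<mu> \<beta>. base.cross \<alpha> \<mu> \<beta> c = 0"
  shows "F c \<in> J"
proof -
  have "F 0 = 0" using assms(3)[of 0 0] by simp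
  then have "add_subgroup {x. F x \<in> J}"
    using add_subgroupD(1,2)[OF assms(1)] by (simp add: add_subgroup_def assms(3))
  then have "c \<in> {x. F x \<in> J}"
    by (rule identities_of_UT2_field) (simp_all add: assms eval_base_comm_ideal)
  then show ?thesis by simp
qed

text \<open>
  The right factor is decomposed as \<open>t + \<Sum> u [x\<^sub>i, x\<^sub>j]\<close>; only in the product with \<open>t\<close> is the
  left factor decomposed as well, as \<open>t' + \<Sum> [x\<^sub>i, x\<^sub>j] u\<close>.
\<close>

lemma decomp_two:
  fixes J :: "'k::field free_alg set"
  assumes J: "add_subgroup J"
    and TT: "\<And>s t. s \<in> triple_ideal \<Longrightarrow> t \<in> triple_ideal \<Longrightarrow> s * t \<in> J"
    and c: "c \<in> comm_ideal" and d: "d \<in> comm_ideal"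
  shows "c * d \<in> J + combos pairs (\<lambda>p c. c * com p) comm_ideal
    + combos pairs (\<lambda>p t. com p * t) triple_ideal" (is "_ \<in> J + ?X + ?Y")
proof -
  have X: "add_subgroup ?X"
    by (rule add_subgroup_combos)
      (simp_all add: add_subgroup_two_sided_ideal comm_ideal algebra_simps)
  have Y: "add_subgroup ?Y"
    by (rule add_subgroup_combos)
      (simp_all add: add_subgroup_two_sided_ideal triple_ideal algebra_simps)
  from subsetD[OF comm_ideal_decomp_left d] obtain t s where d': "d = t + s" "t \<in> triple_ideal"
    "s \<in> combos pairs (\<lambda>p u. u * com p) UNIV"
    by (rule set_plus_elim)
  from subsetD[OF comm_ideal_decomp_right c] obtain t' s' where c': "c = t' + s'" "t' \<in> triple_ideal"
    "s' \<in> combos pairs (\<lambda>p u. com p * u) UNIV"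
    by (rule set_plus_elim)
  have "combos pairs (\<lambda>p u. u * com p) UNIV \<subseteq> {s. c * s \<in> ?X}"
  proof (rule combos_subset)
    show "add_subgroup {s. c * s \<in> ?X}"
      using add_subgroupD[OF X] by (simp add: add_subgroup_def algebra_simps)
    show "u * com p \<in> {s. c * s \<in> ?X}" if "p \<in> pairs" for p u
      using combosI[OF that, of "c * u" comm_ideal "\<lambda>p c. c * com p"] c
      by (simp add: mult.assoc comm_idealD(4))
  qed
  with d'(3) have 1: "c * s \<in> ?X" by blast
  have "combos pairs (\<lambda>p u. com p * u) UNIV \<subseteq> {s. s * t \<in> ?Y}"
  proof (rule combos_subset)
    show "add_subgroup {s. s * t \<in> ?Y}"
      using add_subgroupD[OF Y] by (simp add: add_subgroup_def algebra_simps)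
    show "com p * u \<in> {s. s * t \<in> ?Y}" if "p \<in> pairs" for p u
      using combosI[OF that, of "u * t" triple_ideal "\<lambda>p t. com p * t"] d'(2)
      by (simp add: mult.assoc triple_idealD(3))
  qed
  with c'(3) have 2: "s' * t \<in> ?Y" by blast
  have "t' * t + c * s + s' * t \<in> J + ?X + ?Y"
    by (intro set_plus_intro TT c' d' 1 2)
  moreover have "c * d = t' * t + c * s + s' * t"
    by (simp add: d'(1) c'(1) algebra_simps)
  ultimately show ?thesis by simp
qed

text \<open>
  The two kinds of terms have to be treated in this order. With scalars on the left diagonal, the
  terms \<open>com q * t q\<close> vanish; with scalars on the right diagonal, the terms \<open>c q * com q\<close> need not
  vanish, because \<open>c q\<close> is only in the commutator ideal. They have to be moved to \<open>J\<close> first, which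
  consists of identities.
\<close>

lemma identities_two_aux:
  fixes f :: "'k::field_char_0 free_alg"
  assumes J: "add_subgroup J"
    and TT: "\<And>s t. s \<in> triple_ideal \<Longrightarrow> t \<in> triple_ideal \<Longrightarrow> s * t \<in> J"
    and CCC: "\<And>c d e. c \<in> comm_ideal \<Longrightarrow> d \<in> comm_ideal \<Longrightarrow> e \<in> comm_ideal \<Longrightarrow> c * d * e \<in> J"
    and J0: "J \<subseteq> polynomial_identities (upper2_scale grassmann_scale) (UT2 (graded {..<2} 0))"
    and f: "f \<in> polynomial_identities (upper2_scale grassmann_scale) (UT2 (graded {..<2} 0))"
  shows "f \<in> J"
proof -
  let ?Id = "polynomial_identities (upper2_scale grassmann_scale) (UT2 (graded {..<2} 0 :: 'k grassmann set))"
  let ?X = "combos pairs (\<lambda>p c. c * com p) (comm_ideal :: 'k free_alg set)"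
  let ?Y = "combos pairs (\<lambda>p t. com p * t) (triple_ideal :: 'k free_alg set)"
  have X: "add_subgroup ?X"
    by (rule add_subgroup_combos)
      (simp_all add: add_subgroup_two_sided_ideal comm_ideal algebra_simps)
  have Y: "add_subgroup ?Y"
    by (rule add_subgroup_combos)
      (simp_all add: add_subgroup_two_sided_ideal triple_ideal algebra_simps)
  have "f \<in> J + ?X + ?Y"
    by (rule identities_of_UT2_field)
      (simp_all add: add_subgroup_set_plus J X Y decomp_two TT base_values_of_identity[OF f])
  then obtain g x y where fgxy: "f = g + x + y" "g \<in> J" "x \<in> ?X" "y \<in> ?Y"
    by (auto elim!: set_plus_elim)
  have vanish: "gr.cross a m b h = 0"
    if "h \<in> ?Id" "\<And>i. a i \<in> graded {..<2} 0" "\<And>i. m i \<in> graded {..<2} 0" "\<And>i. b i \<in> graded {..<2} 0"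
    for a m b and h :: "'k free_alg"
    using identity_entries(1)[of a "graded {..<2} 0" m b h] that by simp
  have top: "(area 0 :: 'k grassmann) \<in> graded {..<2} (card {..<2::nat})"
    unfolding card_lessThan by (rule area_graded) auto
  have nil: "nilpart 0 p k \<in> graded {..<2} 1" for p k
    by (rule nilpart_graded) auto
  have ngr: "gscalar c + nilpart 0 p k \<in> graded {..<2} 0" for c :: 'k and p k
    using nil[of p k] graded_mono[of 0 1 "{..<2}" "{..<2}"] by (intro graded_add) auto
  have eig: "(gscalar c + nilpart 0 p k) * area 0 = grassmann_scale c (area 0)"
    "gscalar c * area 0 = grassmann_scale c (area 0)" for c :: 'k and p k
    using eigenvector[OF _ nil top] by (simp_all add: gr.smul_mult_left)
  have faith: "c = 0" if "grassmann_scale c (area 0) = 0" for c :: 'k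
    by (rule scale_faithful[OF gcoeffs_area _ that]) simp

  from fgxy(3) obtain A c where A: "finite A" "A \<subseteq> pairs" "\<And>p. c p \<in> comm_ideal"
    and x: "x = (\<Sum>p\<in>A. c p * com p)" by (elim combosE) blast
  from fgxy(4) obtain B t where B: "finite B" "B \<subseteq> pairs" "\<And>p. t p \<in> triple_ideal"
    and y: "y = (\<Sum>p\<in>B. com p * t p)" by (elim combosE) blast

  have "c p * com p \<in> J" if p: "p \<in> A" for p
  proof (rule identity_criterion[where F = "\<lambda>c. c * com p", OF J])
    fix \<alpha> \<mu> \<beta> :: "nat \<Rightarrow> 'k"
    let ?a = "\<lambda>k. gscalar (\<alpha> k)" and ?m = "\<lambda>k. gscalar (\<mu> k)"
      and ?b = "\<lambda>k. gscalar (\<beta> k) + nilpart 0 p k"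
    have "gr.cross ?a ?m ?b (com q * t q) = 0" for q
      by (simp add: gr.cross_mult eval_triple_ideal[OF B(3)] eval_scalars_comm_ideal[OF com_in_comm_ideal])
    then have "gr.cross ?a ?m ?b y = 0"
      by (simp add: y gr.cross_sum)
    then have "gr.cross ?a ?m ?b x = 0"
      using vanish[OF f, of ?a ?m ?b] vanish[OF subsetD[OF J0 fgxy(2)], of ?a ?m ?b] ngr
      by (simp add: fgxy(1))
    moreover have "gr.cross ?a ?m ?b x = gr.cross ?a ?m ?b (c p * com p)"
      unfolding x gr.cross_sum
    proof (rule sum_isolated[OF A(1) p])
      fix q assume q: "q \<in> A" "q \<noteq> p"
      then show "gr.cross ?a ?m ?b (c q * com q) = 0"
        by (simp add: gr.cross_mult eval_scalars_comm_ideal[OF A(3)]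
            eval_com_nilpart[OF subsetD[OF A(2) p] subsetD[OF A(2) q(1)]])
    qed
    moreover have "gr.cross ?a ?m ?b (c p * com p) = gr.cross ?a ?m ?b (c p) * area 0"
      by (simp add: gr.cross_mult eval_scalars_comm_ideal[OF A(3)]
          eval_com_nilpart[OF subsetD[OF A(2) p] subsetD[OF A(2) p]])
    ultimately have "grassmann_scale (base.cross \<alpha> \<mu> \<beta> (c p)) (area 0) = 0"
      using cross_times_eigenvector[of ?a "area 0" \<alpha> ?m \<mu> ?b \<beta> "c p"] by (simp add: eig)
    then show "base.cross \<alpha> \<mu> \<beta> (c p) = 0" by (rule faith)
  qed (simp_all add: CCC com_in_comm_ideal left_diff_distrib A(3))
  then have xJ: "x \<in> J"
    unfolding x by (intro add_subgroup_sum[OF J])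

  have "com p * t p \<in> J" if p: "p \<in> B" for p
  proof (rule identity_criterion[where F = "\<lambda>c. com p * c", OF J])
    fix \<alpha> \<mu> \<beta> :: "nat \<Rightarrow> 'k"
    let ?a = "\<lambda>k. gscalar (\<alpha> k) + nilpart 0 p k" and ?m = "\<lambda>k. gscalar (\<mu> k)"
      and ?b = "\<lambda>k. gscalar (\<beta> k)"
    have "gr.cross ?a ?m ?b y = 0"
      using vanish[OF f, of ?a ?m ?b] vanish[OF subsetD[OF J0 fgxy(2)], of ?a ?m ?b]
        vanish[OF subsetD[OF J0 xJ], of ?a ?m ?b] ngr
      by (simp add: fgxy(1))
    moreover have "gr.cross ?a ?m ?b y = gr.cross ?a ?m ?b (com p * t p)"
      unfolding y gr.cross_sum
    proof (rule sum_isolated[OF B(1) p])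
      fix q assume q: "q \<in> B" "q \<noteq> p"
      then show "gr.cross ?a ?m ?b (com q * t q) = 0"
        by (simp add: gr.cross_mult eval_triple_ideal[OF B(3)]
            eval_com_nilpart[OF subsetD[OF B(2) p] subsetD[OF B(2) q(1)]])
    qed
    moreover have "gr.cross ?a ?m ?b (com p * t p) = gr.cross ?a ?m ?b (t p) * area 0"
      by (simp add: gr.cross_mult eval_triple_ideal[OF B(3)] area_central
          eval_com_nilpart[OF subsetD[OF B(2) p] subsetD[OF B(2) p]])
    ultimately have "grassmann_scale (base.cross \<alpha> \<mu> \<beta> (t p)) (area 0) = 0"
      using cross_times_eigenvector[of ?a "area 0" \<alpha> ?m \<mu> ?b \<beta> "t p"] by (simp add: eig)
    then show "base.cross \<alpha> \<mu> \<beta> (t p) = 0" by (rule faith)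
  qed (simp_all add: CCC com_in_comm_ideal right_diff_distrib subsetD[OF triple_ideal_subset_comm_ideal B(3)]
      flip: mult.assoc)
  then have "y \<in> J"
    unfolding y by (intro add_subgroup_sum[OF J])
  with xJ fgxy(1,2) show ?thesis by (simp add: add_subgroupD(4)[OF J])
qed


text \<open>
  The products that \<open>J\<close> has to contain are identities themselves, so \<open>J\<close> may be intersected with
  the set of identities.
\<close>

theorem identities_two:
  fixes f :: "'k::field_char_0 free_alg"
  assumes J: "add_subgroup J"
    and TT: "\<And>s t. s \<in> triple_ideal \<Longrightarrow> t \<in> triple_ideal \<Longrightarrow> s * t \<in> J"
    and CCC: "\<And>c d e. c \<in> comm_ideal \<Longrightarrow> d \<in> comm_ideal \<Longrightarrow> e \<in> comm_ideal \<Longrightarrow> c * d * e \<in> J"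
    and f: "f \<in> polynomial_identities (upper2_scale grassmann_scale) (UT2 (graded {..<2} 0))"
  shows "f \<in> J"
proof -
  let ?Id = "polynomial_identities (upper2_scale grassmann_scale) (UT2 (graded {..<2} 0 :: 'k grassmann set))"
  have Id: "T_ideal ?Id" by (rule T_ideal_identities_UT2)
  then have Id': "add_subgroup ?Id"
    by (simp add: T_ideal_def add_subgroup_two_sided_ideal)
  have "f \<in> J \<inter> ?Id"
  proof (rule identities_two_aux)
    show "add_subgroup (J \<inter> ?Id)"
      using J Id' by (simp add: add_subgroup_def)
    show "s * t \<in> J \<inter> ?Id" if "s \<in> triple_ideal" "t \<in> triple_ideal" for s t
      using TT[OF that] triple_products_in_T_ideal[OF Id triple_generator_identity that] by simp
    show "c * d * e \<in> J \<inter> ?Id" if "c \<in> comm_ideal" "d \<in> comm_ideal" "e \<in> comm_ideal" for c d e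
      using CCC[OF that] that
        commutator_products_in_T_ideal[OF Id commutator_generator_identity[of _ 3], of "[c, d, e]"]
      by (simp add: mult.assoc)
  qed (use f in auto)
  then show ?thesis by simp
qed

section \<open>Four nilpotent generators\<close>

definition quads :: "((nat \<times> nat) \<times> (nat \<times> nat)) set"
  where "quads = {(p, q). p \<in> pairs \<and> q \<in> pairs \<and> snd p < fst q}"

definition com2 :: "(nat \<times> nat) \<times> (nat \<times> nat) \<Rightarrow> 'k::field free_alg"
  where "com2 Q = com (fst Q) * com (snd Q)"

text \<open>
  Expand \<open>[x, y z, t]\<close> by the product rule. Modulo triple commutators, a product of two commutators
  thus changes its sign when its two middle entries are exchanged.
\<close>

lemma commutator_exchange: "commutator x y * commutator z t + commutator x z * commutator y t \<in> triple_ideal"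
proof -
  have "commutator (commutator x (y * z)) t - commutator (commutator x y) t * z
      - y * commutator (commutator x z) t - commutator (commutator y t) (commutator x z) \<in> triple_ideal"
    by (intro triple_idealD triple_commutator_in_triple_ideal)
  also have "commutator (commutator x (y * z)) t - commutator (commutator x y) t * z
      - y * commutator (commutator x z) t - commutator (commutator y t) (commutator x z)
    = commutator x y * commutator z t + commutator x z * commutator y t"
    by (simp add: commutator_def algebra_simps)
  finally show ?thesis .
qed

text \<open>
  Up to sign and modulo \<open>triple_ideal\<close>, the element is zero or a product of two commutators of
  variables in strictly increasing order.
\<close>

definition quad_reducible :: "'k::field free_alg \<Rightarrow> bool"
  where "quad_reducible w \<longleftrightarrow>
    w \<in> triple_ideal \<or> (\<exists>Q\<in>quads. w - com2 Q \<in> triple_ideal \<or> w + com2 Q \<in> triple_ideal)"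

lemma quad_reducible_diff:
  assumes "v - w \<in> triple_ideal" "quad_reducible w"
  shows "quad_reducible v"
proof -
  note T = add_subgroupD(4)[OF add_subgroup_two_sided_ideal[OF triple_ideal] assms(1)]
  have "v - u \<in> triple_ideal" if "w - u \<in> triple_ideal" for u
    using T[OF that] by simp
  then have "w \<in> triple_ideal \<Longrightarrow> v \<in> triple_ideal"
    "\<And>Q. w - com2 Q \<in> triple_ideal \<Longrightarrow> v - com2 Q \<in> triple_ideal"
    "\<And>Q. w + com2 Q \<in> triple_ideal \<Longrightarrow> v + com2 Q \<in> triple_ideal"
    by (metis diff_zero, blast, metis diff_minus_eq_add)
  with assms(2) show ?thesis
    unfolding quad_reducible_def by blast
qed

lemma quad_reducible_uminus:
  assumes "quad_reducible w"
  shows "quad_reducible (- w)"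
proof -
  have "w \<in> triple_ideal \<Longrightarrow> - w \<in> triple_ideal"
    by (rule triple_idealD(5))
  moreover have "- w + com2 Q \<in> triple_ideal" if "w - com2 Q \<in> triple_ideal" for Q
    using triple_idealD(5)[OF that] by simp
  moreover have "- w - com2 Q \<in> triple_ideal" if "w + com2 Q \<in> triple_ideal" for Q
    using triple_idealD(5)[OF that] by simp
  ultimately show ?thesis
    using assms unfolding quad_reducible_def by blast
qed

text \<open>
  Together with \<open>commutator_exchange\<close>, commuting the two factors and exchanging the entries of one
  of them generate all permutations of the four entries.
\<close>

lemma quad_reducible_com:
  fixes p q :: "nat \<times> nat"
  assumes "p \<in> pairs" "q \<in> pairs"
  shows "quad_reducible (com p * com q :: 'k::field_char_0 free_alg)"
proof -
  let ?c = "\<lambda>i j. commutator (var i) (var j) :: 'k free_alg"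
  have ex: "quad_reducible (?c i j * ?c k l)" if "quad_reducible (?c i k * ?c j l)" for i j k l
    using quad_reducible_diff[OF _ quad_reducible_uminus[OF that], of "?c i j * ?c k l"]
      commutator_exchange[of "var i" "var j" "var k" "var l"] by simp
  have zero: "?c i i = 0" for i by (simp add: commutator_def)
  have red0: "quad_reducible (0 :: 'k free_alg)" by (simp add: quad_reducible_def triple_idealD)
  have quad: "quad_reducible (?c i j * ?c k l)" if "i < j" "j < k" "k < l" for i j k l
    unfolding quad_reducible_def using that triple_idealD(1)
    by (intro disjI2 bexI[of _ "((i, j), (k, l))"] disjI1)
      (auto simp: quads_def pairs_def com2_def com_def)
  have le: "quad_reducible (?c i j * ?c k l)" if ijkl: "i < j" "k < l" "i \<le> k" for i j k l
  proof -
    consider "i = k" | "j < k" | "i < k" "j = k" | "i < k" "k < j" "j < l" | "k < j" "j = l"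
      | "i < k" "l < j" using ijkl
      by (cases "i = k"; cases j k rule: linorder_cases; cases j l rule: linorder_cases) auto
    then show ?thesis
    proof cases
      case 1
      show ?thesis by (rule ex) (use 1 in \<open>simp add: zero red0\<close>)
    next
      case 2
      then show ?thesis using quad ijkl by simp
    next
      case 3
      let ?w = "?c i j * ?c j l"
      have "?w + ?w \<in> triple_ideal"
        using commutator_exchange[of "var i" "var j" "var j" "var l"] by simp
      \<comment> \<open>An alternating expression with a repeated entry vanishes only where 2 is invertible.\<close>
      then have "Poly_Mapping.single 0 (1 / 2) * (?w + ?w) \<in> triple_ideal"
        by (rule triple_idealD)
      moreover have "Poly_Mapping.single 0 (1 / 2) * (?w + ?w) = ?w"
      proof -
        have "Poly_Mapping.single 0 (1 / 2) * (?w + ?w)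
            = (Poly_Mapping.single 0 (1 / 2) + Poly_Mapping.single 0 (1 / 2)) * ?w"
          by (simp only: distrib_left distrib_right)
        also have "\<dots> = ?w" by (simp flip: single_add)
        finally show ?thesis .
      qed
      ultimately show ?thesis using 3 by (simp add: quad_reducible_def)
    next
      case 4
      show ?thesis by (rule ex) (use quad ijkl 4 in simp)
    next
      case 5
      show ?thesis by (rule ex) (use 5 in \<open>simp add: zero red0\<close>)
    next
      case 6
      have "quad_reducible (- (?c i k * ?c l j))"
        using quad ijkl 6 by (intro quad_reducible_uminus) simp
      also have "- (?c i k * ?c l j) = ?c i k * ?c j l"
        by (simp add: commutator_swap[of "var l" "var j"])
      finally show ?thesis by (rule ex)
    qed
  qed
  obtain i j k l where pq: "p = (i, j)" "q = (k, l)" "i < j" "k < l"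
    using assms by (auto simp: pairs_def)
  show ?thesis
  proof (cases "i \<le> k")
    case True
    then show ?thesis using le pq by (simp add: com_def)
  next
    case False
    then have "quad_reducible (com q * com p :: 'k free_alg)"
      using le pq by (simp add: com_def)
    moreover have "com p * com q - com q * com p \<in> (triple_ideal :: 'k free_alg set)"
      using triple_commutator_in_triple_ideal[of "var i" "var j" "com q"]
      by (simp add: pq com_def commutator_def)
    ultimately show ?thesis using quad_reducible_diff by blast
  qed
qed

lemma quad_combos:
  fixes w :: "'k::field free_alg"
  assumes J: "add_subgroup J"
    and TT: "\<And>s t. s \<in> triple_ideal \<Longrightarrow> t \<in> triple_ideal \<Longrightarrow> s * t \<in> J"
    and t: "t \<in> triple_ideal" and w: "quad_reducible w"
  shows "t * w \<in> J + combos quads (\<lambda>Q t. t * com2 Q) triple_ideal"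
    "w * t \<in> J + combos quads (\<lambda>Q t. com2 Q * t) triple_ideal"
proof -
  have T: "add_subgroup (triple_ideal :: 'k free_alg set)"
    by (simp add: add_subgroup_two_sided_ideal triple_ideal)
  have X: "add_subgroup (combos quads (\<lambda>Q t. t * com2 Q) (triple_ideal :: 'k free_alg set))"
    "add_subgroup (combos quads (\<lambda>Q t. com2 Q * t) (triple_ideal :: 'k free_alg set))"
    by (rule add_subgroup_combos; simp add: T algebra_simps)+
  have t': "- t \<in> triple_ideal" using t by (rule triple_idealD)
  from w consider "w \<in> triple_ideal" | Q where "Q \<in> quads" "w - com2 Q \<in> triple_ideal"
    | Q where "Q \<in> quads" "w + com2 Q \<in> triple_ideal"
    unfolding quad_reducible_def by blast
  then have "t * w \<in> J + combos quads (\<lambda>Q t. t * com2 Q) triple_ideal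
    \<and> w * t \<in> J + combos quads (\<lambda>Q t. com2 Q * t) triple_ideal"
  proof cases
    case 1
    then show ?thesis using TT t X by (simp add: set_plus_left)
  next
    case 2
    have "t * w = t * (w - com2 Q) + t * com2 Q" "w * t = (w - com2 Q) * t + com2 Q * t"
      by (simp_all add: algebra_simps)
    then show ?thesis
      using set_plus_intro[OF TT[OF t 2(2)] combosI[OF 2(1) t, of "\<lambda>Q t. t * com2 Q"]]
        set_plus_intro[OF TT[OF 2(2) t] combosI[OF 2(1) t, of "\<lambda>Q t. com2 Q * t"]] by simp
  next
    case 3
    have "t * w = t * (w + com2 Q) + - t * com2 Q" "w * t = (w + com2 Q) * t + com2 Q * - t"
      by (simp_all add: algebra_simps)
    then show ?thesis
      using set_plus_intro[OF TT[OF t 3(2)] combosI[OF 3(1) t', of "\<lambda>Q t. t * com2 Q"]]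
        set_plus_intro[OF TT[OF 3(2) t] combosI[OF 3(1) t', of "\<lambda>Q t. com2 Q * t"]] by simp
  qed
  then show "t * w \<in> J + combos quads (\<lambda>Q t. t * com2 Q) triple_ideal"
    "w * t \<in> J + combos quads (\<lambda>Q t. com2 Q * t) triple_ideal" by simp_all
qed

text \<open>
  The outer factors are written as \<open>t' + \<Sum> [x\<^sub>i, x\<^sub>j] u\<close> and \<open>t + \<Sum> u [x\<^sub>i, x\<^sub>j]\<close>. If one of them
  contributes a factor in \<open>triple_ideal\<close>, the middle factor is decomposed too, and the two
  commutators that are then adjacent can be sorted, because they are needed only modulo
  \<open>triple_ideal\<close>.
\<close>

lemma decomp_three:
  fixes J :: "'k::field_char_0 free_alg set"
  assumes J: "add_subgroup J"
    and TT: "\<And>s t. s \<in> triple_ideal \<Longrightarrow> t \<in> triple_ideal \<Longrightarrow> s * t \<in> J"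
    and c: "c \<in> comm_ideal" and d: "d \<in> comm_ideal" and e: "e \<in> comm_ideal"
  shows "c * d * e \<in> J + combos quads (\<lambda>Q t. t * com2 Q) triple_ideal
    + combos quads (\<lambda>Q t. com2 Q * t) triple_ideal
    + combos (pairs \<times> pairs) (\<lambda>(p, q) c. com p * c * com q) comm_ideal"
    (is "_ \<in> J + ?X + ?Y + ?Z")
proof -
  let ?W = "J + ?X + ?Y + ?Z"
  let ?L = "combos pairs (\<lambda>p u. u * com p) (UNIV :: 'k free_alg set)"
  let ?R = "combos pairs (\<lambda>p u. com p * u) (UNIV :: 'k free_alg set)"
  note C = add_subgroup_two_sided_ideal[OF comm_ideal]
    and T = add_subgroup_two_sided_ideal[OF triple_ideal]
  have X: "add_subgroup ?X" and Y: "add_subgroup ?Y"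
    by (rule add_subgroup_combos; simp add: T algebra_simps)+
  have Z: "add_subgroup ?Z"
    by (rule add_subgroup_combos) (auto simp: C algebra_simps)
  note JX = add_subgroup_set_plus[OF J X]
  note JXY = add_subgroup_set_plus[OF JX Y]
  note W = add_subgroup_set_plus[OF JXY Z]
  have JW: "h \<in> ?W" if "h \<in> J" for h
    by (intro set_plus_left X Y Z that)
  have XW: "h \<in> ?W" if "h \<in> J + ?X" for h
    by (intro set_plus_left Y Z that)
  have YW: "h \<in> ?W" if "h \<in> J + ?Y" for h
  proof -
    from that obtain g y where h: "h = g + y" "g \<in> J" "y \<in> ?Y" by (rule set_plus_elim)
    have "g + y \<in> J + ?X + ?Y"
      by (rule set_plus_intro[OF set_plus_left[OF X h(2)] h(3)])
    then show ?thesis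
      unfolding h(1) by (rule set_plus_left[OF Z])
  qed
  have ZW: "h \<in> ?W" if "h \<in> ?Z" for h
    by (intro set_plus_right JXY that)
  have right_T: "t * d' * s \<in> ?W" if t: "t \<in> triple_ideal" and d': "d' \<in> comm_ideal" and s: "s \<in> ?L"
    for t d' s
  proof -
    have "?L \<subseteq> {s. t * d' * s \<in> ?W}"
    proof (rule combos_subset)
      show "add_subgroup {s. t * d' * s \<in> ?W}"
        using add_subgroupD[OF W] by (simp add: add_subgroup_def algebra_simps)
      fix q and u :: "'k free_alg"
      assume q: "q \<in> pairs"
      have "d' * u \<in> comm_ideal" using d' by (rule comm_idealD)
      from subsetD[OF comm_ideal_decomp_left this] obtain t' s' where ts': "d' * u = t' + s'"
        "t' \<in> triple_ideal" "s' \<in> ?L" by (rule set_plus_elim)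
      have "t * (t' * com q) \<in> ?W"
        by (intro JW TT t triple_idealD(4) ts')
      moreover have "t * (s' * com q) \<in> ?W"
      proof -
        have "?L \<subseteq> {s. t * (s * com q) \<in> ?W}"
        proof (rule combos_subset)
          show "add_subgroup {s. t * (s * com q) \<in> ?W}"
            using add_subgroupD[OF W] by (simp add: add_subgroup_def algebra_simps)
          show "w * com r \<in> {s. t * (s * com q) \<in> ?W}" if "r \<in> pairs" for r w
            using XW[OF quad_combos(1)[OF J TT triple_idealD(4)[OF t] quad_reducible_com[OF that q]]]
            by (simp add: mult.assoc)
        qed
        with ts'(3) show ?thesis by blast
      qed
      ultimately have "t * (t' * com q) + t * (s' * com q) \<in> ?W"
        by (rule add_subgroupD(4)[OF W])
      moreover have "t * d' * (u * com q) = t * (t' * com q) + t * (s' * com q)"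
        using arg_cong[OF ts'(1), of "\<lambda>x. t * (x * com q)"] by (simp add: algebra_simps)
      ultimately show "u * com q \<in> {s. t * d' * s \<in> ?W}" by simp
    qed
    with s show ?thesis by blast
  qed
  have left_T: "s * (d' * t) \<in> ?W" if t: "t \<in> triple_ideal" and d': "d' \<in> comm_ideal" and s: "s \<in> ?R"
    for t d' s
  proof -
    have "?R \<subseteq> {s. s * (d' * t) \<in> ?W}"
    proof (rule combos_subset)
      show "add_subgroup {s. s * (d' * t) \<in> ?W}"
        using add_subgroupD[OF W] by (simp add: add_subgroup_def algebra_simps)
      fix p and u :: "'k free_alg"
      assume p: "p \<in> pairs"
      have "u * d' \<in> comm_ideal" using d' by (rule comm_idealD)
      from subsetD[OF comm_ideal_decomp_right this] obtain t' s' where ts': "u * d' = t' + s'"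
        "t' \<in> triple_ideal" "s' \<in> ?R" by (rule set_plus_elim)
      have "com p * t' * t \<in> ?W"
        by (intro JW TT t triple_idealD(3) ts')
      moreover have "com p * s' * t \<in> ?W"
      proof -
        have "?R \<subseteq> {s. com p * s * t \<in> ?W}"
        proof (rule combos_subset)
          show "add_subgroup {s. com p * s * t \<in> ?W}"
            using add_subgroupD[OF W] by (simp add: add_subgroup_def algebra_simps)
          show "com r * w \<in> {s. com p * s * t \<in> ?W}" if "r \<in> pairs" for r w
            using YW[OF quad_combos(2)[OF J TT triple_idealD(3)[OF t] quad_reducible_com[OF p that]]]
            by (simp add: mult.assoc)
        qed
        with ts'(3) show ?thesis by blast
      qed
      ultimately have "com p * t' * t + com p * s' * t \<in> ?W"
        by (rule add_subgroupD(4)[OF W])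
      moreover have "com p * u * (d' * t) = com p * t' * t + com p * s' * t"
        using arg_cong[OF ts'(1), of "\<lambda>x. com p * x * t"] by (simp add: algebra_simps)
      ultimately show "com p * u \<in> {s. s * (d' * t) \<in> ?W}" by simp
    qed
    with s show ?thesis by blast
  qed
  have middle: "s * d * s' \<in> ?W" if s: "s \<in> ?R" and s': "s' \<in> ?L" for s s'
  proof -
    have "com p * v * d * s' \<in> ?W" if p: "p \<in> pairs" for p v
    proof -
      have "?L \<subseteq> {s'. com p * v * d * s' \<in> ?W}"
      proof (rule combos_subset)
        show "add_subgroup {s'. com p * v * d * s' \<in> ?W}"
          using add_subgroupD[OF W] by (simp add: add_subgroup_def algebra_simps)
        show "u * com q \<in> {s'. com p * v * d * s' \<in> ?W}" if q: "q \<in> pairs" for q u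
        proof -
          have "v * d * u \<in> comm_ideal"
            by (intro comm_idealD(4) comm_idealD(3) d)
          then have "com p * (v * d * u) * com q \<in> ?Z"
            using combosI[of "(p, q)" "pairs \<times> pairs" "v * d * u" comm_ideal
                "\<lambda>(p, q) c. com p * c * com q"] p q by simp
          from ZW[OF this] show ?thesis by (simp add: mult.assoc)
        qed
      qed
      with s' show ?thesis by blast
    qed
    moreover have "add_subgroup {s. s * d * s' \<in> ?W}"
      using add_subgroupD[OF W] by (simp add: add_subgroup_def algebra_simps)
    ultimately have "?R \<subseteq> {s. s * d * s' \<in> ?W}"
      by (intro combos_subset) auto
    with s show ?thesis by blast
  qed
  from subsetD[OF comm_ideal_decomp_left e] obtain t s where e': "e = t + s" "t \<in> triple_ideal"
    "s \<in> ?L" by (rule set_plus_elim)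
  from subsetD[OF comm_ideal_decomp_right c] obtain t' s' where c': "c = t' + s'" "t' \<in> triple_ideal"
    "s' \<in> ?R" by (rule set_plus_elim)
  have "t' * d * t \<in> ?W"
    by (intro JW TT triple_idealD(4) c' e')
  moreover have "t' * d * s \<in> ?W" by (rule right_T[OF c'(2) d e'(3)])
  moreover have "s' * (d * t) \<in> ?W" by (rule left_T[OF e'(2) d c'(3)])
  moreover have "s' * d * s \<in> ?W" by (rule middle[OF c'(3) e'(3)])
  ultimately have "t' * d * t + t' * d * s + (s' * (d * t) + s' * d * s) \<in> ?W"
    by (intro add_subgroupD(4)[OF W])
  then show ?thesis by (simp add: e'(1) c'(1) algebra_simps)
qed


text \<open>
  Four generators at the four variables of \<open>Q\<close>; they make \<open>com2 Q\<close> the only nonzero product of this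
  form (\<open>eval_com2_nilpart\<close>).
\<close>

definition nilpart2 :: "(nat \<times> nat) \<times> (nat \<times> nat) \<Rightarrow> nat \<Rightarrow> 'k::field grassmann"
  where "nilpart2 Q k = nilpart 0 (fst Q) k + nilpart 2 (snd Q) k"

lemma eval_com2_nilpart:
  assumes P: "P \<in> quads" and Q: "Q \<in> quads"
  shows "eval_poly grassmann_scale (\<lambda>k. gscalar (\<beta> k) + nilpart2 P k) (com2 Q)
    = (if Q = P then area 0 * area 2 else (0 :: 'k::field grassmann))"
proof -
  obtain i j k l where P': "P = ((i, j), (k, l))" "i < j" "j < k" "k < l"
    using P by (auto simp: quads_def pairs_def)
  obtain i' j' k' l' where Q': "Q = ((i', j'), (k', l'))" "i' < j'" "j' < k'" "k' < l'"
    using Q by (auto simp: quads_def pairs_def)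
  let ?\<nu> = "nilpart2 P :: nat \<Rightarrow> 'k grassmann"
  have e: "eval_poly grassmann_scale (\<lambda>k. gscalar (\<beta> k) + ?\<nu> k) (com2 Q)
      = commutator (?\<nu> i') (?\<nu> j') * commutator (?\<nu> k') (?\<nu> l')"
    by (simp add: com2_def eval_com Q'(1))
  show ?thesis
  proof (cases "Q = P")
    case True
    then have "?\<nu> i' = ggen 0" "?\<nu> j' = ggen 1" "?\<nu> k' = ggen 2" "?\<nu> l' = ggen 3"
      using P' Q' by (simp_all add: nilpart2_def nilpart_def numeral_eq_Suc)
    then show ?thesis
      unfolding e using True by (simp add: area_def numeral_eq_Suc)
  next
    case False
    have "\<not> {i', j', k', l'} \<subseteq> {i, j, k, l}"
    proof
      assume sub: "{i', j', k', l'} \<subseteq> {i, j, k, l}"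
      moreover have "card {i', j', k', l'} = card {i, j, k, l}"
        using P' Q' by simp
      ultimately have eq: "set [i', j', k', l'] = set [i, j, k, l]"
        by (simp add: card_subset_eq)
      have "[i', j', k', l'] = [i, j, k, l]"
        by (rule sorted_distinct_set_unique[OF _ _ _ _ eq]) (use P' Q' in auto)
      with False P' Q' show False by simp
    qed
    then obtain x where x: "x \<in> {i', j', k', l'}" "x \<notin> {i, j, k, l}" by blast
    then have "?\<nu> x = 0" by (simp add: nilpart2_def nilpart_def P')
    with x(1) show ?thesis unfolding e using False by (auto simp: commutator_def)
  qed
qed

lemma UT2_mono: "R \<subseteq> R' \<Longrightarrow> UT2 R \<subseteq> UT2 R'"
  by (auto simp: UT2_def)

lemma identities_antimono:
  "A \<subseteq> B \<Longrightarrow> polynomial_identities smul B \<subseteq> polynomial_identities smul A"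
  by (auto simp: polynomial_identities_def)

text \<open>
  The terms with a middle coefficient come first. With two generators on either diagonal, a product
  of two commutators vanishes on each diagonal, and this removes the other terms as well as the
  terms with \<open>cross\<close> at the outer commutators. Once these terms are in \<open>J\<close>, one diagonal can be kept
  scalar and all four generators placed on the other.
\<close>

lemma identities_four:
  fixes f :: "'k::field_char_0 free_alg"
  assumes J: "add_subgroup J"
    and TT: "\<And>s t. s \<in> triple_ideal \<Longrightarrow> t \<in> triple_ideal \<Longrightarrow> s * t \<in> J"
    and CCCC: "\<And>c d e g. c \<in> comm_ideal \<Longrightarrow> d \<in> comm_ideal \<Longrightarrow> e \<in> comm_ideal \<Longrightarrow>
      g \<in> comm_ideal \<Longrightarrow> c * d * e * g \<in> J"
    and J0: "J \<subseteq> polynomial_identities (upper2_scale grassmann_scale) (UT2 (graded {..<4} 0))"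
    and f: "f \<in> polynomial_identities (upper2_scale grassmann_scale) (UT2 (graded {..<4} 0))"
  shows "f \<in> J"
proof -
  let ?Id = "polynomial_identities (upper2_scale grassmann_scale) (UT2 (graded {..<4} 0 :: 'k grassmann set))"
  let ?X = "combos quads (\<lambda>Q t. t * com2 Q) (triple_ideal :: 'k free_alg set)"
  let ?Y = "combos quads (\<lambda>Q t. com2 Q * t) (triple_ideal :: 'k free_alg set)"
  let ?Z = "combos (pairs \<times> pairs) (\<lambda>(p, q) c. com p * c * com q) (comm_ideal :: 'k free_alg set)"
  note C = add_subgroup_two_sided_ideal[OF comm_ideal]
    and T = add_subgroup_two_sided_ideal[OF triple_ideal]
  have X: "add_subgroup ?X" and Y: "add_subgroup ?Y"
    by (rule add_subgroup_combos; simp add: T algebra_simps)+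
  have Z: "add_subgroup ?Z"
    by (rule add_subgroup_combos) (auto simp: C algebra_simps)
  have sub: "(graded {..<2} 0 :: 'k grassmann set) \<subseteq> graded {..<4} 0"
    by (rule graded_mono) auto
  have f2: "f \<in> polynomial_identities (upper2_scale grassmann_scale) (UT2 (graded {..<2} 0))"
    by (rule subsetD[OF identities_antimono[OF UT2_mono[OF sub]] f])
  have "f \<in> J + ?X + ?Y + ?Z"
  proof (rule identities_two[OF _ _ _ f2])
    show "add_subgroup (J + ?X + ?Y + ?Z)"
      by (intro add_subgroup_set_plus J X Y Z)
    show "s * t \<in> J + ?X + ?Y + ?Z" if "s \<in> triple_ideal" "t \<in> triple_ideal" for s t
      by (intro set_plus_left X Y Z TT that)
    show "c * d * e \<in> J + ?X + ?Y + ?Z"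
      if "c \<in> comm_ideal" "d \<in> comm_ideal" "e \<in> comm_ideal" for c d e
      by (rule decomp_three[OF J TT that])
  qed
  then obtain g x y z where fg: "f = g + x + y + z" "g \<in> J" "x \<in> ?X" "y \<in> ?Y" "z \<in> ?Z"
    by (auto elim!: set_plus_elim)
  from fg(3) obtain A r where A: "finite A" "A \<subseteq> quads" "\<And>Q. r Q \<in> triple_ideal"
    and x: "x = (\<Sum>Q\<in>A. r Q * com2 Q)" by (elim combosE) blast
  from fg(4) obtain B s where B: "finite B" "B \<subseteq> quads" "\<And>Q. s Q \<in> triple_ideal"
    and y: "y = (\<Sum>Q\<in>B. com2 Q * s Q)" by (elim combosE) blast
  from fg(5) obtain D c where D: "finite D" "D \<subseteq> pairs \<times> pairs" "\<And>i. c i \<in> comm_ideal"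
    and z: "z = (\<Sum>i\<in>D. com (fst i) * c i * com (snd i))"
    by (elim combosE) (auto simp: case_prod_unfold)

  have vanish: "gr.cross a m b h = 0"
    if "h \<in> ?Id" "\<And>i. a i \<in> graded {..<4} 0" "\<And>i. m i \<in> graded {..<4} 0" "\<And>i. b i \<in> graded {..<4} 0"
    for a m b and h :: "'k free_alg"
    using identity_entries(1)[of a "graded {..<4} 0" m b h] that by simp
  let ?z = "area 0 * area 2 :: 'k grassmann"
  have top: "?z \<in> graded {..<4} (card {..<4::nat})"
  proof -
    have "?z \<in> graded {..<4} (2 + 2)"
      by (intro graded_mult area_graded) auto
    then show ?thesis by simp
  qed
  have faith: "c = 0" if "grassmann_scale c ?z = 0" for c :: 'k
  proof (rule scale_faithful[OF _ _ that])
    show "gcoeffs ?z = Poly_Mapping.single ({|0, Suc 0|} |\<union>| {|2, Suc 2|}) (2 * 2)"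
      by (rule gcoeffs_mult_single[OF gcoeffs_area gcoeffs_area]) auto
  qed simp
  have nil: "nilpart n p k \<in> graded {..<4} 1" if "Suc n < 4" for n p k
    using that by (intro nilpart_graded) auto
  have nil2: "nilpart2 Q k \<in> graded {..<4} 1" for Q k
    unfolding nilpart2_def by (intro graded_add nil) auto
  have near: "gscalar c + \<nu> \<in> graded S 0" if "\<nu> \<in> graded S 1" for c :: 'k and \<nu> S
    using that graded_mono[of 0 1 S S] by (intro graded_add) auto
  have eig: "(gscalar c + \<nu>) * ?z = grassmann_scale c ?z" if "\<nu> \<in> graded {..<4} 1" for c :: 'k and \<nu>
    by (rule eigenvector[OF _ that top]) simp
  have eig0: "gscalar c * ?z = grassmann_scale c ?z" for c :: 'k
    by (simp add: gr.smul_mult_left)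
  have two: "eval_poly grassmann_scale a (h * h') = 0"
    if "\<And>i. a i \<in> graded S 0" "h \<in> comm_ideal" "h' \<in> comm_ideal" "finite S" "card S < 4"
    for a S and h h' :: "'k free_alg"
    using graded_eq_0[OF graded_mult[OF eval_comm_ideal_graded[OF that(1,2)]
        eval_comm_ideal_graded[OF that(1,3)]] that(4)] that(5) by simp
  have com2_eq: "com2 Q = com (fst Q) * (com (snd Q) :: 'k free_alg)" for Q
    by (simp add: com2_def)

  have "com (fst i) * c i * com (snd i) \<in> J" if i: "i \<in> D" for i
  proof (rule identity_criterion[where F = "\<lambda>c. com (fst i) * c * com (snd i)", OF J])
    fix \<alpha> \<mu> \<beta> :: "nat \<Rightarrow> 'k"
    let ?a = "\<lambda>k. gscalar (\<alpha> k) + nilpart 0 (fst i) k" and ?m = "\<lambda>k. gscalar (\<mu> k)"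
      and ?b = "\<lambda>k. gscalar (\<beta> k) + nilpart 2 (snd i) k"
    have a: "?a k \<in> graded {0, 1} 0" and b: "?b k \<in> graded {2, 3} 0" for k
      by (intro near nilpart_graded; simp)+
    have mem: "?a k \<in> graded {..<4} 0" "?b k \<in> graded {..<4} 0" for k
      by (intro near nil; simp)+
    have twoa: "eval_poly grassmann_scale ?a (h * h') = 0"
      and twob: "eval_poly grassmann_scale ?b (h * h') = 0"
      if "h \<in> comm_ideal" "h' \<in> comm_ideal" for h h' :: "'k free_alg"
      using two[OF a that] two[OF b that] by simp_all
    have "gr.cross ?a ?m ?b (r Q * com2 Q) = 0" for Q
      using twob[OF com_in_comm_ideal com_in_comm_ideal, of "fst Q" "snd Q"]
      by (simp add: gr.cross_mult eval_triple_ideal[OF A(3)] com2_eq)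
    then have "gr.cross ?a ?m ?b x = 0" by (simp add: x gr.cross_sum)
    moreover have "gr.cross ?a ?m ?b (com2 Q * s Q) = 0" for Q
      using twoa[OF com_in_comm_ideal com_in_comm_ideal, of "fst Q" "snd Q"]
      by (simp add: gr.cross_mult eval_triple_ideal[OF B(3)] com2_eq)
    then have "gr.cross ?a ?m ?b y = 0" by (simp add: y gr.cross_sum)
    ultimately have "gr.cross ?a ?m ?b z = 0"
      using vanish[OF f, of ?a ?m ?b] vanish[OF subsetD[OF J0 fg(2)], of ?a ?m ?b] mem
      by (simp add: fg(1))
    moreover have outer: "gr.cross ?a ?m ?b (com (fst j) * c j * com (snd j))
        = eval_poly grassmann_scale ?a (com (fst j)) * gr.cross ?a ?m ?b (c j) *
          eval_poly grassmann_scale ?b (com (snd j))" for j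
    proof -
      have "gr.cross ?a ?m ?b (com (fst j)) * eval_poly grassmann_scale ?b (c j) *
          eval_poly grassmann_scale ?b (com (snd j)) = 0"
        using twob[OF D(3) com_in_comm_ideal, of j "snd j"] by (simp add: mult.assoc)
      with twoa[OF com_in_comm_ideal D(3), of "fst j" j] show ?thesis
        by (simp add: gr.cross_mult distrib_right)
    qed
    have mem_i: "fst i \<in> pairs" "snd i \<in> pairs" using D(2) i by auto
    have "gr.cross ?a ?m ?b z = gr.cross ?a ?m ?b (com (fst i) * c i * com (snd i))"
      unfolding z gr.cross_sum
    proof (rule sum_isolated[OF D(1) i])
      fix j assume j: "j \<in> D" "j \<noteq> i"
      then have "fst j \<in> pairs" "snd j \<in> pairs" using D(2) by auto
      moreover have "fst j \<noteq> fst i \<or> snd j \<noteq> snd i" using j(2) by (simp add: prod_eq_iff)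
      ultimately show "gr.cross ?a ?m ?b (com (fst j) * c j * com (snd j)) = 0"
        unfolding outer using eval_com_nilpart[OF mem_i(1), of "fst j" \<alpha> 0]
          eval_com_nilpart[OF mem_i(2), of "snd j" \<beta> 2] by auto
    qed
    also have "\<dots> = area 0 * gr.cross ?a ?m ?b (c i) * area 2"
      unfolding outer by (simp add: eval_com_nilpart mem_i)
    also have "\<dots> = gr.cross ?a ?m ?b (c i) * ?z"
      by (simp only: area_central[of 0 "gr.cross ?a ?m ?b (c i)"] mult.assoc)
    also have "\<dots> = grassmann_scale (base.cross \<alpha> \<mu> \<beta> (c i)) ?z"
      by (intro cross_times_eigenvector eig eig0 nil; simp)
    finally have "grassmann_scale (base.cross \<alpha> \<mu> \<beta> (c i)) ?z = 0"
      using \<open>gr.cross ?a ?m ?b z = 0\<close> by argo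
    then show "base.cross \<alpha> \<mu> \<beta> (c i) = 0" by (rule faith)
  next
    show "com (fst i) * (c * d) * com (snd i) \<in> J" if "c \<in> comm_ideal" "d \<in> comm_ideal" for c d
      using CCCC[OF com_in_comm_ideal that com_in_comm_ideal] by (simp add: mult.assoc)
  qed (simp_all add: D(3) algebra_simps)
  then have zJ: "z \<in> J" unfolding z by (intro add_subgroup_sum[OF J])

  have "r Q * com2 Q \<in> J" if Q: "Q \<in> A" for Q
  proof (rule identity_criterion[where F = "\<lambda>c. c * com2 Q", OF J])
    fix \<alpha> \<mu> \<beta> :: "nat \<Rightarrow> 'k"
    let ?a = "\<lambda>k. gscalar (\<alpha> k)" and ?m = "\<lambda>k. gscalar (\<mu> k)"
      and ?b = "\<lambda>k. gscalar (\<beta> k) + nilpart2 Q k"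
    have mem: "?b k \<in> graded {..<4} 0" for k by (intro near nil2)
    have "gr.cross ?a ?m ?b (com2 R * s R) = 0" for R
      by (simp add: gr.cross_mult eval_triple_ideal[OF B(3)] com2_eq
          eval_scalars_comm_ideal[OF com_in_comm_ideal])
    then have "gr.cross ?a ?m ?b y = 0" by (simp add: y gr.cross_sum)
    then have 0: "gr.cross ?a ?m ?b x = 0"
      using vanish[OF f, of ?a ?m ?b] vanish[OF subsetD[OF J0 fg(2)], of ?a ?m ?b]
        vanish[OF subsetD[OF J0 zJ], of ?a ?m ?b] mem by (simp add: fg(1))
    have "gr.cross ?a ?m ?b x = gr.cross ?a ?m ?b (r Q * com2 Q)"
      unfolding x gr.cross_sum
    proof (rule sum_isolated[OF A(1) Q])
      fix R assume R: "R \<in> A" "R \<noteq> Q"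
      then show "gr.cross ?a ?m ?b (r R * com2 R) = 0"
        by (simp add: gr.cross_mult eval_triple_ideal[OF A(3)]
            eval_com2_nilpart[OF subsetD[OF A(2) Q] subsetD[OF A(2) R(1)]])
    qed
    also have "\<dots> = gr.cross ?a ?m ?b (r Q) * ?z"
      by (simp add: gr.cross_mult eval_triple_ideal[OF A(3)]
          eval_com2_nilpart[OF subsetD[OF A(2) Q] subsetD[OF A(2) Q]])
    also have "\<dots> = grassmann_scale (base.cross \<alpha> \<mu> \<beta> (r Q)) ?z"
      by (intro cross_times_eigenvector eig eig0 nil2)
    finally have "grassmann_scale (base.cross \<alpha> \<mu> \<beta> (r Q)) ?z = 0"
      using 0 by argo
    then show "base.cross \<alpha> \<mu> \<beta> (r Q) = 0" by (rule faith)
  next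
    show "c * d * com2 Q \<in> J" if "c \<in> comm_ideal" "d \<in> comm_ideal" for c d
      using CCCC[OF that com_in_comm_ideal com_in_comm_ideal] by (simp add: com2_eq mult.assoc)
  qed (simp_all add: left_diff_distrib subsetD[OF triple_ideal_subset_comm_ideal A(3)])
  then have xJ: "x \<in> J" unfolding x by (intro add_subgroup_sum[OF J])

  have "com2 Q * s Q \<in> J" if Q: "Q \<in> B" for Q
  proof (rule identity_criterion[where F = "\<lambda>c. com2 Q * c", OF J])
    fix \<alpha> \<mu> \<beta> :: "nat \<Rightarrow> 'k"
    let ?a = "\<lambda>k. gscalar (\<alpha> k) + nilpart2 Q k" and ?m = "\<lambda>k. gscalar (\<mu> k)"
      and ?b = "\<lambda>k. gscalar (\<beta> k)"
    have mem: "?a k \<in> graded {..<4} 0" for k by (intro near nil2)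
    have 0: "gr.cross ?a ?m ?b y = 0"
      using vanish[OF f, of ?a ?m ?b] vanish[OF subsetD[OF J0 fg(2)], of ?a ?m ?b]
        vanish[OF subsetD[OF J0 zJ], of ?a ?m ?b] vanish[OF subsetD[OF J0 xJ], of ?a ?m ?b] mem
      by (simp add: fg(1))
    have "gr.cross ?a ?m ?b y = gr.cross ?a ?m ?b (com2 Q * s Q)"
      unfolding y gr.cross_sum
    proof (rule sum_isolated[OF B(1) Q])
      fix R assume R: "R \<in> B" "R \<noteq> Q"
      then show "gr.cross ?a ?m ?b (com2 R * s R) = 0"
        by (simp add: gr.cross_mult eval_triple_ideal[OF B(3)]
            eval_com2_nilpart[OF subsetD[OF B(2) Q] subsetD[OF B(2) R(1)]])
    qed
    also have "\<dots> = ?z * gr.cross ?a ?m ?b (s Q)"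
      by (simp add: gr.cross_mult eval_triple_ideal[OF B(3)]
          eval_com2_nilpart[OF subsetD[OF B(2) Q] subsetD[OF B(2) Q]])
    also have "\<dots> = gr.cross ?a ?m ?b (s Q) * ?z"
      by (simp only: mult.assoc area_central[of 2 "gr.cross ?a ?m ?b (s Q)"])
        (simp only: area_central[of 0 "gr.cross ?a ?m ?b (s Q)"] flip: mult.assoc)
    also have "\<dots> = grassmann_scale (base.cross \<alpha> \<mu> \<beta> (s Q)) ?z"
      by (intro cross_times_eigenvector eig eig0 nil2)
    finally have "grassmann_scale (base.cross \<alpha> \<mu> \<beta> (s Q)) ?z = 0"
      using 0 by argo
    then show "base.cross \<alpha> \<mu> \<beta> (s Q) = 0" by (rule faith)
  next
    show "com2 Q * (c * d) \<in> J" if "c \<in> comm_ideal" "d \<in> comm_ideal" for c d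
      using CCCC[OF com_in_comm_ideal com_in_comm_ideal that] by (simp add: com2_eq mult.assoc)
  qed (simp_all add: right_diff_distrib subsetD[OF triple_ideal_subset_comm_ideal B(3)])
  then have "y \<in> J" unfolding y by (intro add_subgroup_sum[OF J])
  with xJ zJ fg(1,2) show ?thesis by (simp add: add_subgroupD(4)[OF J])
qed


section \<open>The T-ideals of the two algebras\<close>

lemma identities_generated:
  fixes J :: "'k::field_char_0 free_alg set"
  assumes "1 \<le> m" "m \<le> 2" and J: "T_ideal J"
    and J1: "commutator (commutator (var 0) (var 1)) (var 2) *
      commutator (commutator (var 3) (var 4)) (var 5) \<in> J"
    and J2: "(\<Prod>i\<leftarrow>[0..<m + 2]. commutator (var (2 * i)) (var (2 * i + 1))) \<in> J"
    and J0: "J \<subseteq> polynomial_identities (upper2_scale grassmann_scale) (UT2 (graded {..<2 * m} 0))"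
  shows "polynomial_identities (upper2_scale grassmann_scale) (UT2 (graded {..<2 * m} 0)) \<subseteq> J"
proof
  fix f
  assume f: "f \<in> polynomial_identities (upper2_scale grassmann_scale)
    (UT2 (graded {..<2 * m} 0 :: 'k grassmann set))"
  have J': "add_subgroup J"
    using J by (simp add: T_ideal_def add_subgroup_two_sided_ideal)
  have products: "prod_list cs \<in> J" if "set cs \<subseteq> comm_ideal" "length cs = m + 2" for cs
    using commutator_products_in_T_ideal[OF J J2 that] .
  consider "m = 1" | "m = 2" using assms(1,2) by linarith
  then show "f \<in> J"
  proof cases
    case 1
    have CCC: "c * d * e \<in> J" if "c \<in> comm_ideal" "d \<in> comm_ideal" "e \<in> comm_ideal" for c d e
      using products[of "[c, d, e]"] that 1 by (simp add: mult.assoc)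
    show ?thesis
      by (rule identities_two[OF J' triple_products_in_T_ideal[OF J J1] CCC]) (use f 1 in simp_all)
  next
    case 2
    have CCCC: "c * d * e * g \<in> J"
      if "c \<in> comm_ideal" "d \<in> comm_ideal" "e \<in> comm_ideal" "g \<in> comm_ideal" for c d e g
      using products[of "[c, d, e, g]"] that 2 by (simp add: mult.assoc)
    show ?thesis
      by (rule identities_four[OF J' triple_products_in_T_ideal[OF J J1] CCCC])
        (use f J0 2 in simp_all)
  qed
qed

theorem theorem15:
  fixes m :: nat
  assumes "1 \<le> m" and "m \<le> 2"
  shows "polynomial_identities (upper2_scale grassmann_scale)
           (UT2 (grassmann_alg (2 * m) :: 'k::field_char_0 grassmann set)) =
         polynomial_identities (upper2_scale grassmann_scale)
           (UT2 (grassmann_alg (2 * m + 1) :: 'k grassmann set)) \<and>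
         polynomial_identities (upper2_scale grassmann_scale)
           (UT2 (grassmann_alg (2 * m + 1) :: 'k grassmann set)) =
         T_ideal hull
           {commutator (commutator (var 0) (var 1)) (var 2) *
              commutator (commutator (var 3) (var 4)) (var 5),
            (\<Prod>i\<leftarrow>[0..<m + 2]. commutator (var (2 * i)) (var (2 * i + 1)))}"
proof -
  let ?Id = "\<lambda>k. polynomial_identities (upper2_scale grassmann_scale)
    (UT2 (graded {..<k} 0 :: 'k grassmann set))"
  let ?G = "{commutator (commutator (var 0) (var 1)) (var 2) *
      commutator (commutator (var 3) (var 4)) (var 5),
    (\<Prod>i\<leftarrow>[0..<m + 2]. commutator (var (2 * i)) (var (2 * i + 1)))} :: 'k free_alg set"
  have "T_ideal hull ?G \<subseteq> ?Id (2 * m + 1)"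
  proof (rule hull_minimal)
    show "?G \<subseteq> ?Id (2 * m + 1)"
      using triple_generator_identity commutator_generator_identity[of "{..<2 * m + 1}" "m + 2"] by auto
  qed (rule T_ideal_identities_UT2)
  moreover have mono: "?Id (2 * m + 1) \<subseteq> ?Id (2 * m)"
  proof -
    have "(graded {..<2 * m} 0 :: 'k grassmann set) \<subseteq> graded {..<2 * m + 1} 0"
      by (rule graded_mono) auto
    then show ?thesis
      by (intro identities_antimono UT2_mono)
  qed
  ultimately have "?Id (2 * m) \<subseteq> T_ideal hull ?G"
    using assms by (intro identities_generated[of m] T_ideal_hull) (auto intro: hull_inc)
  with \<open>T_ideal hull ?G \<subseteq> ?Id (2 * m + 1)\<close> mono show ?thesis
    unfolding grassmann_alg_eq_graded by blast
qed

end
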